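(* There exists a procedure $P$ that does not use preconditions and uses only tgds in its postconditions, such that the following problem is undecidable: given an instance $I$, is the set $\mathrm{outcomes}_P(I)$ nonempty?
   Context: Fix disjoint countably infinite sets of attribute names (totally ordered), domain values $D$, and relation names. A schema $S$ is a partial function with finite domain from relation names to finite sets of attributes; "$R$ is in $S$" means $S(R)$ is defined. An instance $I$ of $S$ assigns to each $R$ in $S$ a finite set $R^I$ of tuples, i.e. functions $S(R)\to D$ (also written as value lists in attribute order). A named atom $R(A_1:x_1,\dots,A_k:x_k)$ (the $x_i$ are variables) is compatible with $S$ if $\{A_1,\dots,A_k\}\subseteq S(R)$; $(I,\tau)$ satisfies it if some $t\in R^I$ has $t(A_i)=\tau(x_i)$ for all $i$. A conjunctive query (CQ) is $\exists \bar z\,\phi(\bar z,\bar y)$ with $\phi$ a conjunction of named atoms; it is compatible with $S$ if all its atoms are, and $Q(I)$ is its set of answers $\tau(\bar y)$. A total query is a relation name $R$; it is compatible with $S$ if $R$ is in $S$, and its result is the set of all (unnamed) tuples in $R^I$. A tgd is $\forall \bar x(\exists \bar y\,\phi(\bar x,\bar y)\to\exists\bar z\,\psi(\bar x,\bar z))$, where $\phi,\psi$ are conjunctions of named atoms. $I\models\Sigma$ means that every CQ in $\Sigma$ is compatible with the schema of $I$ and every dependency in $\Sigma$ holds in $I$ in the usual first-order sense. A structure constraint is $R[\bar s]$ ($\bar s$ a tuple of attributes) or $R[*]$; a schema $S$ satisfies $R[\bar s]$ if $R$ is in $S$ and all attributes of $\bar s$ belong to $S(R)$, and satisfies $R[*]$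 if $R$ is in $S$. A procedure is $P=(\mathrm{Scope},C_{in},C_{out},Q_{pres})$: $\mathrm{Scope}$ is a set of structure constraints, $C_{in}$ and $C_{out}$ (pre- and postconditions) are sets of constraints, and $Q_{pres}$ is a set of queries (CQs or total queries). $P$ is applicable on $I$ over $S$ if each query in $Q_{pres}$ is compatible with $S$ and $I\models C_{in}$. An instance $I'$ over the same schema $S$ is a possible outcome of applying $P$ to $I$ if (1) $P$ is applicable on $I$; (2) $I'\models C_{out}$; (3) $I$ and $I'$ agree outside the scope: $R^I=R^{I'}$ for every $R$ in $S$ not mentioned in $\mathrm{Scope}$, and for every $T$ in $S$ mentioned in $\mathrm{Scope}$ with $T[*]\notin\mathrm{Scope}$, the projections of $T^I$ and $T^{I'}$ onto the attributes of $S(T)$ not mentioned in any $T[\bar s]\in\mathrm{Scope}$ coincide; (4) $Q(I)\subseteq Q(I')$ for each $Q\in Q_{pres}$. $\mathrm{outcomes}_P(I)$ is the set of all possible outcomes. *)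

theory Defs
  imports Main "HOL-Library.Nat_Bijection"
begin

text \<open>Attribute names, domain values and relation names: three separate countably infinite types.\<close>

datatype attr = Attr (attr_idx: nat)
datatype val = Val (val_idx: nat)
datatype rel = Rel (rel_idx: nat)

instantiation attr :: linorder
begin

definition less_eq_attr :: "attr \<Rightarrow> attr \<Rightarrow> bool" where
  "A \<le> B \<longleftrightarrow> attr_idx A \<le> attr_idx B"

definition less_attr :: "attr \<Rightarrow> attr \<Rightarrow> bool" where
  "A < B \<longleftrightarrow> attr_idx A < attr_idx B"

instance
  by standard (auto simp: less_eq_attr_def less_attr_def intro: attr.expand)

end

type_synonym schema = "rel \<rightharpoonup> attr set"
type_synonym tuple = "attr \<rightharpoonup> val"

definition schema_wf :: "schema \<Rightarrow> bool" where
  "schema_wf S \<longleftrightarrow> finite (dom S) \<and> (\<forall>X \<in> ran S. finite X)"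

text \<open>An instance carries its schema, which the relations alone do not determine when
  some of them are empty.\<close>

datatype db = DB (schema: schema) (ext: "rel \<Rightarrow> tuple set")

definition db_wf :: "db \<Rightarrow> bool" where
  "db_wf I \<longleftrightarrow> schema_wf (schema I) \<and>
     (\<forall>R X. schema I R = Some X \<longrightarrow> finite (ext I R) \<and> (\<forall>t \<in> ext I R. dom t = X)) \<and>
     (\<forall>R. R \<notin> dom (schema I) \<longrightarrow> ext I R = {})"

text \<open>The value list of a tuple, in attribute order; used on tuples with finite domain.\<close>

definition unnamed :: "tuple \<Rightarrow> val list" where
  "unnamed t = map (\<lambda>A. the (t A)) (sorted_list_of_set (dom t))"

type_synonym var = nat

datatype named_atom = Atom (atom_rel: rel) (atom_args: "(attr \<times> var) list")

definition atom_wf :: "named_atom \<Rightarrow> bool" where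
  "atom_wf a \<longleftrightarrow> distinct (map fst (atom_args a))"

definition atom_compatible :: "schema \<Rightarrow> named_atom \<Rightarrow> bool" where
  "atom_compatible S a \<longleftrightarrow> (\<exists>X. S (atom_rel a) = Some X \<and> fst ` set (atom_args a) \<subseteq> X)"

definition atom_sat :: "db \<Rightarrow> (var \<Rightarrow> val) \<Rightarrow> named_atom \<Rightarrow> bool" where
  "atom_sat I \<tau> a \<longleftrightarrow>
     (\<exists>t \<in> ext I (atom_rel a). \<forall>(A, x) \<in> set (atom_args a). t A = Some (\<tau> x))"

text \<open>A list of atoms is read as their conjunction.\<close>

type_synonym conj = "named_atom list"

definition conj_vars :: "conj \<Rightarrow> var set" where
  "conj_vars \<phi> = (\<Union>a \<in> set \<phi>. snd ` set (atom_args a))"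

definition conj_wf :: "conj \<Rightarrow> bool" where
  "conj_wf \<phi> \<longleftrightarrow> \<phi> \<noteq> [] \<and> (\<forall>a \<in> set \<phi>. atom_wf a)"

definition conj_compatible :: "schema \<Rightarrow> conj \<Rightarrow> bool" where
  "conj_compatible S \<phi> \<longleftrightarrow> (\<forall>a \<in> set \<phi>. atom_compatible S a)"

definition conj_sat :: "db \<Rightarrow> (var \<Rightarrow> val) \<Rightarrow> conj \<Rightarrow> bool" where
  "conj_sat I \<tau> \<phi> \<longleftrightarrow> (\<forall>a \<in> set \<phi>. atom_sat I \<tau> a)"

text \<open>Satisfaction at \<open>\<tau>\<close> of the conjunctive query with matrix \<open>\<phi>\<close> and free variables \<open>ys\<close>;
  all other variables of \<open>\<phi>\<close> are existentially quantified.\<close>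

definition cq_sat :: "db \<Rightarrow> (var \<Rightarrow> val) \<Rightarrow> var list \<Rightarrow> conj \<Rightarrow> bool" where
  "cq_sat I \<tau> ys \<phi> \<longleftrightarrow> (\<exists>\<sigma>. (\<forall>y \<in> set ys. \<sigma> y = \<tau> y) \<and> conj_sat I \<sigma> \<phi>)"

datatype query = CQ "var list" conj | Total rel

fun query_wf :: "query \<Rightarrow> bool" where
  "query_wf (CQ ys \<phi>) \<longleftrightarrow> conj_wf \<phi> \<and> set ys \<subseteq> conj_vars \<phi>"
| "query_wf (Total R) \<longleftrightarrow> True"

fun query_compatible :: "schema \<Rightarrow> query \<Rightarrow> bool" where
  "query_compatible S (CQ ys \<phi>) \<longleftrightarrow> conj_compatible S \<phi>"
| "query_compatible S (Total R) \<longleftrightarrow> R \<in> dom S"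

fun answers :: "query \<Rightarrow> db \<Rightarrow> val list set" where
  "answers (CQ ys \<phi>) I = {map \<tau> ys |\<tau>. cq_sat I \<tau> ys \<phi>}"
| "answers (Total R) I = unnamed ` ext I R"

datatype structure_constraint =
    Cols (sc_rel: rel) "attr list"
  | Whole (sc_rel: rel)

fun structure_sat :: "schema \<Rightarrow> structure_constraint \<Rightarrow> bool" where
  "structure_sat S (Cols R s) \<longleftrightarrow> (\<exists>X. S R = Some X \<and> set s \<subseteq> X)"
| "structure_sat S (Whole R) \<longleftrightarrow> R \<in> dom S"

text \<open>\<open>Tgd xs \<phi> \<psi>\<close> has universally quantified variables \<open>xs\<close>, shared by body \<open>\<phi>\<close> and head \<open>\<psi>\<close>;
  the remaining variables are quantified existentially, separately on each side.\<close>

datatype constraint =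
    is_Tgd: Tgd "var list" conj conj
  | Egd conj var var
  | Structure structure_constraint

fun constraint_wf :: "constraint \<Rightarrow> bool" where
  "constraint_wf (Tgd xs \<phi> \<psi>) \<longleftrightarrow>
     conj_wf \<phi> \<and> conj_wf \<psi> \<and> set xs \<subseteq> conj_vars \<phi> \<inter> conj_vars \<psi>"
| "constraint_wf (Egd \<phi> x y) \<longleftrightarrow> conj_wf \<phi> \<and> {x, y} \<subseteq> conj_vars \<phi>"
| "constraint_wf (Structure c) \<longleftrightarrow> True"

fun constraint_compatible :: "schema \<Rightarrow> constraint \<Rightarrow> bool" where
  "constraint_compatible S (Tgd xs \<phi> \<psi>) \<longleftrightarrow> conj_compatible S \<phi> \<and> conj_compatible S \<psi>"
| "constraint_compatible S (Egd \<phi> x y) \<longleftrightarrow> conj_compatible S \<phi>"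
| "constraint_compatible S (Structure c) \<longleftrightarrow> True"

fun constraint_holds :: "db \<Rightarrow> constraint \<Rightarrow> bool" where
  "constraint_holds I (Tgd xs \<phi> \<psi>) \<longleftrightarrow> (\<forall>\<tau>. cq_sat I \<tau> xs \<phi> \<longrightarrow> cq_sat I \<tau> xs \<psi>)"
| "constraint_holds I (Egd \<phi> x y) \<longleftrightarrow> (\<forall>\<tau>. conj_sat I \<tau> \<phi> \<longrightarrow> \<tau> x = \<tau> y)"
| "constraint_holds I (Structure c) \<longleftrightarrow> structure_sat (schema I) c"

definition models :: "db \<Rightarrow> constraint set \<Rightarrow> bool" where
  "models I \<Sigma> \<longleftrightarrow> (\<forall>c \<in> \<Sigma>. constraint_compatible (schema I) c \<and> constraint_holds I c)"

datatype proc = Proc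
  (scope: "structure_constraint set")
  (pre: "constraint set")
  (post: "constraint set")
  (pres: "query set")

text \<open>Finiteness is essential: an infinite set of constraints could itself encode an
  undecidable set.\<close>

definition proc_wf :: "proc \<Rightarrow> bool" where
  "proc_wf P \<longleftrightarrow>
     finite (scope P) \<and> finite (pre P) \<and> finite (post P) \<and> finite (pres P) \<and>
     (\<forall>c \<in> pre P \<union> post P. constraint_wf c) \<and> (\<forall>q \<in> pres P. query_wf q)"

definition applicable :: "proc \<Rightarrow> db \<Rightarrow> bool" where
  "applicable P I \<longleftrightarrow> (\<forall>q \<in> pres P. query_compatible (schema I) q) \<and> models I (pre P)"

definition scope_attrs :: "proc \<Rightarrow> rel \<Rightarrow> attr set" where
  "scope_attrs P R = \<Union> {set s |s. Cols R s \<in> scope P}"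

definition project :: "db \<Rightarrow> rel \<Rightarrow> attr set \<Rightarrow> tuple set" where
  "project I R X = (\<lambda>t. t |` X) ` ext I R"

definition agree_outside_scope :: "proc \<Rightarrow> db \<Rightarrow> db \<Rightarrow> bool" where
  "agree_outside_scope P I I' \<longleftrightarrow>
     (\<forall>R X. schema I R = Some X \<longrightarrow>
        (R \<notin> sc_rel ` scope P \<longrightarrow> ext I R = ext I' R) \<and>
        (R \<in> sc_rel ` scope P \<and> Whole R \<notin> scope P \<longrightarrow>
           project I R (X - scope_attrs P R) = project I' R (X - scope_attrs P R)))"

definition outcomes :: "proc \<Rightarrow> db \<Rightarrow> db set" where
  "outcomes P I = {I'. db_wf I' \<and> schema I' = schema I \<and> applicable P I \<and> models I' (post P) \<and>
     agree_outside_scope P I I' \<and> (\<forall>q \<in> pres P. answers q I \<subseteq> answers q I')}"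

text \<open>Partial recursive functions. Functions act on argument lists without a fixed arity;
  an application without a defined value is not in the relation. \<open>PrimRec\<close> recurses on, and \<open>Mu\<close>
  minimises over, the first argument.\<close>

datatype recf = Zero | Succ | Proj nat | Comp recf "recf list" | PrimRec recf recf | Mu recf

inductive computes :: "recf \<Rightarrow> nat list \<Rightarrow> nat \<Rightarrow> bool" where
  zero: "computes Zero xs 0"
| succ: "computes Succ [x] (Suc x)"
| proj: "i < length xs \<Longrightarrow> computes (Proj i) xs (xs ! i)"
| comp: "list_all2 (\<lambda>g y. computes g xs y) gs ys \<Longrightarrow> computes f ys z \<Longrightarrow> computes (Comp f gs) xs z"
| prim_0: "computes f xs y \<Longrightarrow> computes (PrimRec f g) (0 # xs) y"
| prim_Suc: "computes (PrimRec f g) (n # xs) y \<Longrightarrow> computes g (n # y # xs) z \<Longrightarrow>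
    computes (PrimRec f g) (Suc n # xs) z"
| mu: "computes f (n # xs) 0 \<Longrightarrow> (\<forall>i < n. \<exists>y. computes f (i # xs) (Suc y)) \<Longrightarrow>
    computes (Mu f) xs n"

text \<open>Decidability of the problem "given \<open>x \<in> X\<close>, does \<open>Q x\<close> hold?", inputs being presented
  by their codes. Nothing is required on numbers that are not codes.\<close>

definition decidable_on :: "('a \<Rightarrow> nat) \<Rightarrow> 'a set \<Rightarrow> ('a \<Rightarrow> bool) \<Rightarrow> bool" where
  "decidable_on code X Q \<longleftrightarrow>
     (\<exists>f. \<forall>x \<in> X. computes f [code x] (if Q x then 1 else 0))"

text \<open>The numbering of instances: finite sets are coded by \<^const>\<open>set_encode\<close> (binary expansion)
  and pairs by \<^const>\<open>prod_encode\<close> (Cantor pairing).\<close>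

definition tuple_code :: "tuple \<Rightarrow> nat" where
  "tuple_code t = set_encode {prod_encode (attr_idx A, val_idx v) |A v. t A = Some v}"

definition rel_code :: "db \<Rightarrow> rel \<Rightarrow> nat" where
  "rel_code I R = prod_encode (rel_idx R,
     prod_encode (set_encode (attr_idx ` the (schema I R)), set_encode (tuple_code ` ext I R)))"

definition db_code :: "db \<Rightarrow> nat" where
  "db_code I = set_encode (rel_code I ` dom (schema I))"

lemma tuple_code_inj:
  assumes "finite (dom t)" "finite (dom u)" "tuple_code t = tuple_code u"
  shows "t = u"
proof -
  let ?G = "\<lambda>t::tuple. {prod_encode (attr_idx A, val_idx v) |A v. t A = Some v}"
  have fin: "finite (?G t)" if "finite (dom t)" for t :: tuple
  proof (rule finite_subset)
    show "?G t \<subseteq> (\<lambda>A. prod_encode (attr_idx A, val_idx (the (t A)))) ` dom t"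
      by force
    show "finite ((\<lambda>A. prod_encode (attr_idx A, val_idx (the (t A)))) ` dom t)"
      using that by simp
  qed
  have idx: "attr_idx A = attr_idx B \<longleftrightarrow> A = B" "val_idx v = val_idx w \<longleftrightarrow> v = w" for A B v w
    by (metis attr.expand, metis val.expand)
  have mem: "t A = Some v \<longleftrightarrow> prod_encode (attr_idx A, val_idx v) \<in> ?G t" for t :: tuple and A v
    by (simp add: idx)
  have "?G t = ?G u"
    using assms fin unfolding tuple_code_def by (metis (lifting) set_encode_eq)
  then have "t A = Some v \<longleftrightarrow> u A = Some v" for A v
    using mem[of t A v] mem[of u A v] by argo
  then show ?thesis
    by (intro ext) (metis option.exhaust)
qed

lemma db_code_inj: "inj_on db_code {I. db_wf I}"
proof (rule inj_onI, unfold mem_Collect_eq)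
  fix I J assume wf: "db_wf I" "db_wf J" and eq: "db_code I = db_code J"
  have "finite (dom (schema I))" "finite (dom (schema J))"
    using wf by (auto simp: db_wf_def schema_wf_def)
  with eq have codes: "rel_code I ` dom (schema I) = rel_code J ` dom (schema J)"
    by (simp add: db_code_def set_encode_eq)
  have rel: "schema J R = Some X \<and> ext J R = ext I R"
    if wf: "db_wf I" "db_wf J" and R: "schema I R = Some X"
      and codes: "rel_code I ` dom (schema I) = rel_code J ` dom (schema J)" for I J R X
  proof -
    obtain R' Y where R': "schema J R' = Some Y" "rel_code I R = rel_code J R'"
      using R codes by (metis domD domI imageE imageI)
    have "R' = R" using R' by (auto simp: rel_code_def intro: rel.expand)
    note J = R'[unfolded this]
    have fin: "finite X" "finite Y" "finite (ext I R)" "finite (ext J R)"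
      and dom: "\<And>t. t \<in> ext I R \<union> ext J R \<Longrightarrow> finite (dom t)"
      using wf R J(1) by (auto simp: db_wf_def schema_wf_def ran_def)
    have "attr_idx ` X = attr_idx ` Y" "tuple_code ` ext I R = tuple_code ` ext J R"
      using J R fin by (simp_all add: rel_code_def set_encode_eq)
    moreover have "inj attr_idx" by (meson attr.expand injI)
    moreover have "inj_on tuple_code (ext I R \<union> ext J R)"
      using dom by (meson inj_onI tuple_code_inj)
    ultimately show ?thesis
      using J(1) by (metis inj_image_eq_iff inj_on_image_eq_iff sup_ge1 sup_ge2)
  qed
  have sch: "schema I R = schema J R" for R
    by (metis option.exhaust rel[OF wf _ codes] rel[OF wf(2,1) _ codes[symmetric]])
  have "ext I R = ext J R" for R
  proof (cases "schema I R")
    case None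
    with sch[of R] have "R \<notin> dom (schema I)" "R \<notin> dom (schema J)"
      by (simp_all add: domIff)
    with wf show ?thesis by (simp add: db_wf_def)
  next
    case (Some X)
    from rel[OF wf this codes] show ?thesis by simp
  qed
  with sch show "I = J"
    by (intro db.expand) auto
qed

inductive_cases computes_elims:
  "computes Zero xs y" "computes Succ xs y" "computes (Proj i) xs y" "computes (Comp f gs) xs y"
  "computes (PrimRec f g) (0 # xs) y" "computes (PrimRec f g) (Suc n # xs) y"
  "computes (Mu f) xs y"

lemma computes_unique: "computes f xs y \<Longrightarrow> computes f xs z \<Longrightarrow> y = z"
proof (induction arbitrary: z rule: computes.induct)
  case (comp xs gs ys f y)
  from comp.prems obtain zs where zs: "list_all2 (\<lambda>g y. computes g xs y) gs zs" "computes f zs z"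
    by (rule computes_elims)
  have "ys = zs"
    using comp.IH(1) zs(1) by (auto simp: list_all2_conv_all_nth intro: nth_equalityI)
  with comp.IH(2) zs(2) show ?case by blast
next
  case (prim_Suc f g n xs y v)
  from prim_Suc.prems obtain w where "computes (PrimRec f g) (n # xs) w" "computes g (n # w # xs) z"
    by (rule computes_elims)
  with prim_Suc.IH show ?case by blast
next
  case (mu f n xs)
  from mu.prems have z: "computes f (z # xs) 0" "\<forall>i < z. \<exists>y. computes f (i # xs) (Suc y)"
    by (auto elim: computes_elims(7))
  show ?case
  proof (cases n z rule: linorder_cases)
    case less
    with z(2) mu.IH(1) show ?thesis by (metis nat.distinct(1))
  next
    case greater
    with z(1) mu.IH(2) show ?thesis by (metis nat.distinct(1))
  qed
qed (blast elim: computes_elims)+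

end

theory Submission
  imports Defs "HOL-Library.Countable"
begin

text \<open>
  The procedure evaluates partial recursive programs. Relation \<open>Rel 1\<close> holds tagged rows
  describing a program, numbers and argument lists; the tgds are the evaluation rules of
  \<^const>\<open>computes\<close>, together with rules that invent successors and list cells, and a denial
  that forbids the root program to yield \<open>1\<close> on the input number. If the program does yield \<open>1\<close>,
  the tgds force this fact in every outcome. If it yields \<open>0\<close>, there is a finite outcome: numbers
  and list codes are cut off at a bound \<open>B\<close> that exceeds everything in the derivation of \<open>0\<close>, and
  an evaluation fact is declared true unless it contradicts a derivation within the bound.
  The program of an instance is determined by the number coding its rows, so a decider \<open>f\<close> can be
  diagonalised without a universal function: let \<open>h\<close> on \<open>n\<close> run \<open>f\<close> on the instance whose program
  rows have code \<open>n\<close> and whose input is \<open>n\<close>, and take for \<open>n\<close> the code of \<open>h\<close> itself.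
\<close>

subsection \<open>Recursive functions\<close>

text \<open>The argument list is a function of a parameter \<open>a\<close>, so one notion covers
  all arities and the closure rules apply to lambda terms by matching.\<close>

definition recursive_on :: "('a \<Rightarrow> nat list) \<Rightarrow> ('a \<Rightarrow> nat) \<Rightarrow> bool" where
  "recursive_on X f \<longleftrightarrow> (\<exists>r. \<forall>a. computes r (X a) (f a))"

lemma recursive_on_proj:
  assumes "\<And>a. i < length (X a)" "\<And>a. X a ! i = f a"
  shows "recursive_on X f"
  using assms unfolding recursive_on_def by (metis computes.proj)

lemma recursive_on_comp:
  assumes "recursive_on (\<lambda>x. [x]) g" "recursive_on X f"
  shows "recursive_on X (\<lambda>a. g (f a))"
proof -
  from assms obtain r s where "\<And>x. computes r [x] (g x)" "\<And>a. computes s (X a) (f a)"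
    unfolding recursive_on_def by auto
  then have "computes (Comp r [s]) (X a) (g (f a))" for a
    by (intro computes.comp[where ys = "[f a]"]) auto
  then show ?thesis unfolding recursive_on_def by blast
qed

lemma recursive_on_Suc: "recursive_on X f \<Longrightarrow> recursive_on X (\<lambda>a. Suc (f a))"
  by (rule recursive_on_comp[where g = Suc]) (auto simp: recursive_on_def intro: computes.succ)

lemma recursive_on_const: "recursive_on X (\<lambda>a. c)"
proof (induction c)
  case 0
  show ?case unfolding recursive_on_def using computes.zero by blast
qed (rule recursive_on_Suc)

lemma recursive_on_add:
  assumes "recursive_on X f" "recursive_on X g"
  shows "recursive_on X (\<lambda>a. f a + g a)"
proof -
  let ?add = "PrimRec (Proj 0) (Comp Succ [Proj 1])"
  have add: "computes ?add [m, n] (m + n)" for m n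
  proof (induction m)
    case 0
    show ?case using computes.prim_0[OF computes.proj[of 0 "[n]"]] by simp
  next
    case (Suc m)
    have "computes (Proj 1) [m, m + n, n] (m + n)"
      using computes.proj[of 1 "[m, m + n, n]"] by simp
    then have "computes (Comp Succ [Proj 1]) [m, m + n, n] (Suc (m + n))"
      by (intro computes.comp[where ys = "[m + n]"] computes.succ) auto
    with Suc show ?case by (simp add: computes.prim_Suc)
  qed
  from assms obtain r s where "\<And>a. computes r (X a) (f a)" "\<And>a. computes s (X a) (g a)"
    unfolding recursive_on_def by auto
  then have "computes (Comp ?add [r, s]) (X a) (f a + g a)" for a
    by (intro computes.comp[where ys = "[f a, g a]"] add) auto
  then show ?thesis unfolding recursive_on_def by blast
qed

text \<open>Primitive recursion without parameters: the base program runs on the empty list, where a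
  constant suffices.\<close>

lemma recursive_on_rec:
  assumes g: "recursive_on (\<lambda>(n, y). [n, y]) (\<lambda>(n, y). g n y)"
    and f: "\<And>n. f (Suc n) = g n (f n)"
  shows "recursive_on (\<lambda>n. [n]) f"
proof -
  obtain r where r: "computes r [n, y] (g n y)" for n y
    using g unfolding recursive_on_def by auto
  have "recursive_on (\<lambda>_::unit. []) (\<lambda>_. f 0)" by (rule recursive_on_const)
  then obtain s where s: "computes s [] (f 0)" unfolding recursive_on_def by auto
  have "computes (PrimRec s r) [n] (f n)" for n
    by (induction n) (auto simp: f intro: s r computes.prim_0 computes.prim_Suc)
  then show ?thesis unfolding recursive_on_def by blast
qed

lemma recursive_on_sum:
  assumes "recursive_on (\<lambda>n. [n]) f"
  shows "recursive_on (\<lambda>n. [n]) (\<lambda>n. \<Sum>i<n. f i)"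
proof (rule recursive_on_rec[where g = "\<lambda>n y. y + f n"])
  have "recursive_on (\<lambda>(n, y). [n, y]) (\<lambda>p. snd p + f (fst p))"
    by (intro recursive_on_add recursive_on_comp[OF assms]
        recursive_on_proj[of 0] recursive_on_proj[of 1]) auto
  then show "recursive_on (\<lambda>(n, y). [n, y]) (\<lambda>(n, y). y + f n)"
    by (simp add: case_prod_unfold)
qed simp

lemma recursive_on_power2:
  assumes "recursive_on X f"
  shows "recursive_on X (\<lambda>a. 2 ^ f a)"
proof (rule recursive_on_comp[where g = "(^) 2", OF recursive_on_rec assms])
  have "recursive_on (\<lambda>(n, y). [n, y]) (\<lambda>p::nat \<times> nat. snd p + snd p)"
    by (intro recursive_on_add recursive_on_proj[of 1]) auto
  then show "recursive_on (\<lambda>(n, y). [n, y]) (\<lambda>(n::nat, y). y + y)"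
    by (simp add: case_prod_unfold)
qed simp

text \<open>Cantor pairing is a triangular number plus the first component, and triangular numbers
  are sums. In the instance codes below, the first component of each varying pair is a
  constant.\<close>

lemma recursive_on_prod_encode:
  assumes "recursive_on X f"
  shows "recursive_on X (\<lambda>a. prod_encode (k, f a))"
proof -
  have "triangle = (\<lambda>n. \<Sum>i<n. Suc i)"
  proof
    show "triangle n = (\<Sum>i<n. Suc i)" for n by (induction n) auto
  qed
  moreover have "recursive_on (\<lambda>n. [n]) (\<lambda>n. \<Sum>i<n. Suc i)"
    by (intro recursive_on_sum recursive_on_Suc recursive_on_proj[of 0]) auto
  ultimately have tri: "recursive_on (\<lambda>n. [n]) triangle" by simp
  have "recursive_on X (\<lambda>a. triangle (k + f a) + k)"
    by (intro recursive_on_add recursive_on_const recursive_on_comp[OF tri] assms)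
  then show ?thesis by (simp add: prod_encode_def)
qed

subsection \<open>Evaluation rules\<close>

text \<open>Makes \<open>to_nat\<close> available as an injective naming of syntax nodes.\<close>

instance recf :: countable by countable_datatype

definition row :: "nat list \<Rightarrow> tuple" where
  "row xs = (\<lambda>A. if attr_idx A < length xs then Some (Val (xs ! attr_idx A)) else None)"

text \<open>
  The first entry of a row in \<open>Rel 1\<close> is one of the following tags. The tags up to \<open>kMu\<close> describe the
  syntax tree of the program, whose nodes are coded by \<^const>\<open>to_nat\<close>. A row \<open>[kS, m, n, 0]\<close> says that
  \<open>n\<close> is the successor of \<open>m\<close>, and \<open>[kC, l, n, t]\<close> that \<open>l\<close> is the list with head \<open>n\<close> and tail \<open>t\<close>;
  \<open>0\<close> is the number zero and also the empty list. \<open>[kTry, f, l, i]\<close> says that the search of the \<open>Mu\<close>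
  node \<open>f\<close> on \<open>l\<close> has reached \<open>i\<close>. The tag \<open>1\<close> is skipped because the simplifier rewrites it to \<open>Suc 0\<close>.
\<close>

abbreviation (input) "kZero \<equiv> 0::nat"
abbreviation (input) "kSucc \<equiv> 2::nat"
abbreviation (input) "kProj0 \<equiv> 3::nat"
abbreviation (input) "kProjS \<equiv> 4::nat"
abbreviation (input) "kComp \<equiv> 5::nat"
abbreviation (input) "kNil \<equiv> 6::nat"
abbreviation (input) "kCons \<equiv> 7::nat"
abbreviation (input) "kPrim \<equiv> 8::nat"
abbreviation (input) "kMu \<equiv> 9::nat"
abbreviation (input) "kRoot \<equiv> 10::nat"
abbreviation (input) "kIn \<equiv> 11::nat"
abbreviation (input) "kElem \<equiv> 12::nat"
abbreviation (input) "kS \<equiv> 13::nat"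
abbreviation (input) "kC \<equiv> 14::nat"
abbreviation (input) "kEval \<equiv> 15::nat"
abbreviation (input) "kEvals \<equiv> 16::nat"
abbreviation (input) "kTry \<equiv> 17::nat"

text \<open>
  The only row of relation \<open>Rel 0\<close>. As this relation is outside the scope, an atom over it makes the
  variables \<open>i < 18\<close> act as the constants \<open>Val i\<close>.
\<close>

abbreviation "consts \<equiv> row [0..<18]"

type_synonym pattern = "(nat \<times> nat \<times> nat \<times> nat) list"

definition pattern_vars :: "pattern \<Rightarrow> nat set" where
  "pattern_vars b = (\<Union>(t, x, y, z) \<in> set b. {t, x, y, z})"

definition pattern_sat :: "(nat \<Rightarrow> nat \<Rightarrow> nat \<Rightarrow> nat \<Rightarrow> bool) \<Rightarrow> (nat \<Rightarrow> nat) \<Rightarrow> pattern \<Rightarrow> bool" where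
  "pattern_sat F e b \<longleftrightarrow> (\<forall>(t, x, y, z) \<in> set b. F (e t) (e x) (e y) (e z))"

text \<open>The valuation \<open>e\<close> matches the body and \<open>d\<close> the head. Head
  variables absent from the body are existential; variables below 18 are pinned, as the atom over
  \<open>Rel 0\<close> will do.\<close>

definition satisfies :: "(nat \<Rightarrow> nat \<Rightarrow> nat \<Rightarrow> nat \<Rightarrow> bool) \<Rightarrow> pattern \<Rightarrow> pattern \<Rightarrow> bool" where
  "satisfies F b h \<longleftrightarrow> (\<forall>e. (\<forall>i<18. e i = i) \<longrightarrow> pattern_sat F e b \<longrightarrow>
     (\<exists>d. (\<forall>x \<in> pattern_vars b. x \<in> pattern_vars h \<longrightarrow> d x = e x) \<and> (\<forall>i<18. d i = i) \<and> pattern_sat F d h))"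

definition rules :: "(pattern \<times> pattern) list" where
  "rules =
    [([], [(kElem,0,0,0)]),
     ([(kS,18,19,0)], [(kElem,19,0,0)]),
     ([(kC,18,19,20)], [(kElem,18,0,0)]),
     ([(kElem,18,0,0)], [(kS,18,19,0)]),
     ([(kElem,18,0,0), (kElem,19,0,0)], [(kC,20,18,19)]),
     ([(kZero,18,0,0), (kElem,19,0,0)], [(kEval,18,19,0)]),
     ([(kSucc,18,0,0), (kC,19,20,0), (kS,20,21,0)], [(kEval,18,19,21)]),
     ([(kProj0,18,0,0), (kC,19,20,21)], [(kEval,18,19,20)]),
     ([(kProjS,18,19,0), (kC,20,21,22), (kEval,19,22,23)], [(kEval,18,20,23)]),
     ([(kNil,18,0,0), (kElem,19,0,0)], [(kEvals,18,19,0)]),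
     ([(kCons,18,19,20), (kEval,19,21,22), (kEvals,20,21,23), (kC,24,22,23)], [(kEvals,18,21,24)]),
     ([(kComp,18,19,20), (kEvals,20,21,22), (kEval,19,22,23)], [(kEval,18,21,23)]),
     ([(kPrim,18,19,20), (kC,21,0,22), (kEval,19,22,23)], [(kEval,18,21,23)]),
     ([(kPrim,18,19,20), (kS,21,22,0), (kC,23,22,24), (kC,25,21,24), (kEval,18,25,26),
       (kC,27,26,24), (kC,28,21,27), (kEval,20,28,29)], [(kEval,18,23,29)]),
     ([(kMu,18,19,0), (kElem,20,0,0)], [(kTry,18,20,0)]),
     ([(kMu,18,19,0), (kTry,18,20,21), (kC,22,21,20), (kEval,19,22,23), (kS,24,23,0), (kS,21,25,0)],
      [(kTry,18,20,25)]),
     ([(kMu,18,19,0), (kTry,18,20,21), (kC,22,21,20), (kEval,19,22,0)], [(kEval,18,20,21)])]"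

text \<open>The rules as plain closure conditions on a four-place relation, so that both directions
  of the reduction can avoid patterns.\<close>

locale eval_closed =
  fixes F :: "nat \<Rightarrow> nat \<Rightarrow> nat \<Rightarrow> nat \<Rightarrow> bool"
  assumes elem_0: "F kElem 0 0 0"
    and elem_S: "F kS m n 0 \<Longrightarrow> F kElem n 0 0"
    and elem_C: "F kC l n t \<Longrightarrow> F kElem l 0 0"
    and ex_S: "F kElem m 0 0 \<Longrightarrow> \<exists>n. F kS m n 0"
    and ex_C: "F kElem n 0 0 \<Longrightarrow> F kElem t 0 0 \<Longrightarrow> \<exists>l. F kC l n t"
    and eval_Zero: "F kZero f 0 0 \<Longrightarrow> F kElem l 0 0 \<Longrightarrow> F kEval f l 0"
    and eval_Succ: "F kSucc f 0 0 \<Longrightarrow> F kC l m 0 \<Longrightarrow> F kS m n 0 \<Longrightarrow> F kEval f l n"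
    and eval_Proj0: "F kProj0 f 0 0 \<Longrightarrow> F kC l n t \<Longrightarrow> F kEval f l n"
    and eval_ProjS: "F kProjS f g 0 \<Longrightarrow> F kC l n t \<Longrightarrow> F kEval g t v \<Longrightarrow> F kEval f l v"
    and evals_Nil: "F kNil gs 0 0 \<Longrightarrow> F kElem l 0 0 \<Longrightarrow> F kEvals gs l 0"
    and evals_Cons: "F kCons gs g hs \<Longrightarrow> F kEval g l v \<Longrightarrow> F kEvals hs l t \<Longrightarrow> F kC m v t \<Longrightarrow> F kEvals gs l m"
    and eval_Comp: "F kComp f g gs \<Longrightarrow> F kEvals gs l m \<Longrightarrow> F kEval g m v \<Longrightarrow> F kEval f l v"
    and eval_Prim0: "F kPrim f g h \<Longrightarrow> F kC l 0 t \<Longrightarrow> F kEval g t v \<Longrightarrow> F kEval f l v"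
    and eval_PrimS: "F kPrim f g h \<Longrightarrow> F kS m n 0 \<Longrightarrow> F kC l n t \<Longrightarrow> F kC l' m t \<Longrightarrow> F kEval f l' v \<Longrightarrow>
      F kC a v t \<Longrightarrow> F kC b m a \<Longrightarrow> F kEval h b w \<Longrightarrow> F kEval f l w"
    and try_0: "F kMu f g 0 \<Longrightarrow> F kElem l 0 0 \<Longrightarrow> F kTry f l 0"
    and try_S: "F kMu f g 0 \<Longrightarrow> F kTry f l m \<Longrightarrow> F kC a m l \<Longrightarrow> F kEval g a v \<Longrightarrow> F kS u v 0 \<Longrightarrow>
      F kS m n 0 \<Longrightarrow> F kTry f l n"
    and eval_Mu: "F kMu f g 0 \<Longrightarrow> F kTry f l m \<Longrightarrow> F kC a m l \<Longrightarrow> F kEval g a 0 \<Longrightarrow> F kEval f l m"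

lemma satisfies_rules_iff: "(\<forall>(b, h) \<in> set rules. satisfies F b h) \<longleftrightarrow> eval_closed F"
proof
  assume S: "\<forall>(b, h) \<in> set rules. satisfies F b h"
  \<comment> \<open>The list \<open>vs\<close> supplies the values of the variables 18, 19 and so
    on.\<close>
  define env :: "nat list \<Rightarrow> nat \<Rightarrow> nat" where "env vs i = (if i < 18 then i else vs ! (i - 18))" for vs i
  have inst: "\<exists>d. (\<forall>x \<in> pattern_vars (fst (rules ! i)). x \<in> pattern_vars (snd (rules ! i)) \<longrightarrow> d x = env vs x) \<and>
      (\<forall>i<18. d i = i) \<and> pattern_sat F d (snd (rules ! i))"
    if "i < length rules" "pattern_sat F (env vs) (fst (rules ! i))" for i vs
  proof -
    have "satisfies F (fst (rules ! i)) (snd (rules ! i))"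
      using S that(1) by (metis (no_types, lifting) case_prod_beta nth_mem)
    moreover have "\<forall>i<18. env vs i = i" by (simp add: env_def)
    ultimately show ?thesis
      unfolding satisfies_def using that(2) by blast
  qed
  note [simp] = rules_def pattern_vars_def pattern_sat_def env_def
  show "eval_closed F"
  proof
    show "F kElem 0 0 0" using inst[of 0 "[]"] by auto
    show "F kElem n 0 0" if "F kS m n 0" for m n
      using inst[of 1 "[m, n]"] that by auto
    show "F kElem l 0 0" if "F kC l n t" for l n t
      using inst[of 2 "[l, n, t]"] that by auto
    show "\<exists>n. F kS m n 0" if "F kElem m 0 0" for m
      using inst[of 3 "[m]"] that by auto
    show "\<exists>l. F kC l n t" if "F kElem n 0 0" "F kElem t 0 0" for n t
      using inst[of 4 "[n, t]"] that by auto
    show "F kEval f l 0" if "F kZero f 0 0" "F kElem l 0 0" for f l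
      using inst[of 5 "[f, l]"] that by auto
    show "F kEval f l n" if "F kSucc f 0 0" "F kC l m 0" "F kS m n 0" for f l m n
      using inst[of 6 "[f, l, m, n]"] that by auto
    show "F kEval f l n" if "F kProj0 f 0 0" "F kC l n t" for f l n t
      using inst[of 7 "[f, l, n, t]"] that by auto
    show "F kEval f l v" if "F kProjS f g 0" "F kC l n t" "F kEval g t v" for f g l n t v
      using inst[of 8 "[f, g, l, n, t, v]"] that by auto
    show "F kEvals gs l 0" if "F kNil gs 0 0" "F kElem l 0 0" for gs l
      using inst[of 9 "[gs, l]"] that by auto
    show "F kEvals gs l m" if "F kCons gs g hs" "F kEval g l v" "F kEvals hs l t" "F kC m v t" for gs g hs l v t m
      using inst[of 10 "[gs, g, hs, l, v, t, m]"] that by auto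
    show "F kEval f l v" if "F kComp f g gs" "F kEvals gs l m" "F kEval g m v" for f g gs l m v
      using inst[of 11 "[f, g, gs, l, m, v]"] that by auto
    show "F kEval f l v" if "F kPrim f g h" "F kC l 0 t" "F kEval g t v" for f g h l t v
      using inst[of 12 "[f, g, h, l, t, v]"] that by auto
    show "F kEval f l w" if "F kPrim f g h" "F kS m n 0" "F kC l n t" "F kC l' m t" "F kEval f l' v"
      "F kC a v t" "F kC b m a" "F kEval h b w" for f g h m n l t l' v a b w
      using inst[of 13 "[f, g, h, m, n, l, t, l', v, a, b, w]"] that by auto
    show "F kTry f l 0" if "F kMu f g 0" "F kElem l 0 0" for f g l
      using inst[of 14 "[f, g, l]"] that by auto
    show "F kTry f l n" if "F kMu f g 0" "F kTry f l m" "F kC a m l" "F kEval g a v" "F kS u v 0" "F kS m n 0"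
      for f g l m a v u n
      using inst[of 15 "[f, g, l, m, a, v, u, n]"] that by auto
    show "F kEval f l m" if "F kMu f g 0" "F kTry f l m" "F kC a m l" "F kEval g a 0" for f g l m a
      using inst[of 16 "[f, g, l, m, a]"] that by auto
  qed
next
  assume "eval_closed F"
  then interpret eval_closed F .
  note [simp] = pattern_vars_def pattern_sat_def
  \<comment> \<open>All rules but two have no existential head variable, so \<open>d = e\<close>
    serves for them. The two exceptions invent a successor and a list cell.\<close>
  have full: "satisfies F b h"
    if "\<And>e. \<forall>i<18. e i = i \<Longrightarrow> pattern_sat F e b \<Longrightarrow> pattern_sat F e h" for b h
    unfolding satisfies_def using that by blast
  have "satisfies F [(kElem,18,0,0)] [(kS,18,19,0)]"
    unfolding satisfies_def
  proof (intro allI impI)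
    fix e :: "nat \<Rightarrow> nat" assume e: "\<forall>i<18. e i = i" "pattern_sat F e [(kElem,18,0,0)]"
    with ex_S obtain n where "F kS (e 18) n 0" by auto
    with e show "\<exists>d. (\<forall>x \<in> pattern_vars [(kElem,18,0,0)]. x \<in> pattern_vars [(kS,18,19,0)] \<longrightarrow> d x = e x) \<and>
        (\<forall>i<18. d i = i) \<and> pattern_sat F d [(kS,18,19,0)]"
      by (intro exI[of _ "e(19 := n)"]) auto
  qed
  moreover have "satisfies F [(kElem,18,0,0), (kElem,19,0,0)] [(kC,20,18,19)]"
    unfolding satisfies_def
  proof (intro allI impI)
    let ?b = "[(kElem,18,0,0), (kElem,19,0,0)]" and ?h = "[(kC,20,18,19)]"
    fix e :: "nat \<Rightarrow> nat" assume e: "\<forall>i<18. e i = i" "pattern_sat F e ?b"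
    with ex_C[of "e 18" "e 19"] obtain l where "F kC l (e 18) (e 19)" by auto
    with e show "\<exists>d. (\<forall>x \<in> pattern_vars ?b. x \<in> pattern_vars ?h \<longrightarrow> d x = e x) \<and>
        (\<forall>i<18. d i = i) \<and> pattern_sat F d ?h"
      by (intro exI[of _ "e(20 := l)"]) auto
  qed
  ultimately show "\<forall>(b, h) \<in> set rules. satisfies F b h"
    by (simp add: rules_def del: pattern_sat_def, intro conjI full, simp_all)
      ((elim conjE)?,
        (rule elem_0 | erule elem_S | erule elem_C | erule (1) eval_Zero | erule (2) eval_Succ
        | erule (1) eval_Proj0 | erule (2) eval_ProjS | erule (1) evals_Nil | erule (3) evals_Cons
        | erule (2) eval_Comp | erule (2) eval_Prim0 | erule (7) eval_PrimS | erule (1) try_0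
        | erule (5) try_S | erule (3) eval_Mu))+
qed

text \<open>A projection becomes a chain down to \<open>Proj 0\<close>, each link dropping a list
  head, because finitely many rules must serve all indices. Lists of programs have nodes of their
  own.\<close>

fun prog :: "recf \<Rightarrow> nat list set" and progs :: "recf list \<Rightarrow> nat list set" where
  "prog Zero = {[kZero, to_nat Zero, 0, 0]}"
| "prog Succ = {[kSucc, to_nat Succ, 0, 0]}"
| "prog (Proj i) = insert [kProj0, to_nat (Proj 0), 0, 0]
     ((\<lambda>j. [kProjS, to_nat (Proj (Suc j)), to_nat (Proj j), 0]) ` {..<i})"
| "prog (Comp f gs) = insert [kComp, to_nat (Comp f gs), to_nat f, to_nat gs] (prog f \<union> progs gs)"
| "prog (PrimRec f g) = insert [kPrim, to_nat (PrimRec f g), to_nat f, to_nat g] (prog f \<union> prog g)"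
| "prog (Mu f) = insert [kMu, to_nat (Mu f), to_nat f, 0] (prog f)"
| "progs [] = {[kNil, to_nat ([] :: recf list), 0, 0]}"
| "progs (g # gs) = insert [kCons, to_nat (g # gs), to_nat g, to_nat gs] (prog g \<union> progs gs)"

section \<open>Evaluation facts forced by the rules\<close>

context eval_closed
begin

text \<open>
  Elements are nulls in general: an element may represent several numbers, and a number may have
  several representatives.
\<close>

inductive num :: "nat \<Rightarrow> nat \<Rightarrow> bool" where
  num_0: "num 0 0"
| num_Suc: "num u k \<Longrightarrow> F kS u v 0 \<Longrightarrow> num v (Suc k)"

inductive nums :: "nat \<Rightarrow> nat list \<Rightarrow> bool" where
  nums_Nil: "nums 0 []"
| nums_Cons: "num n k \<Longrightarrow> nums t ks \<Longrightarrow> F kC l n t \<Longrightarrow> nums l (k # ks)"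

inductive_cases num_0E: "num v 0"
inductive_cases num_SucE: "num v (Suc k)"
inductive_cases nums_ConsE: "nums l (k # ks)"

lemma num_elem: "num v k \<Longrightarrow> F kElem v 0 0"
  by (erule num.cases) (auto intro: elem_0 elem_S)

lemma nums_elem: "nums l ks \<Longrightarrow> F kElem l 0 0"
  by (erule nums.cases) (auto intro: elem_0 elem_C)


definition has :: "nat list set \<Rightarrow> bool" where
  "has X \<longleftrightarrow> (\<forall>t a b c. [t, a, b, c] \<in> X \<longrightarrow> F t a b c)"

lemma has_simps [simp]:
  "has {}" "has (insert [t, a, b, c] X) \<longleftrightarrow> F t a b c \<and> has X" "has (X \<union> Y) \<longleftrightarrow> has X \<and> has Y"
  by (auto simp: has_def)

text \<open>Each \<open>kProjS\<close> row removes the head of the list, until \<open>kProj0\<close>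
  returns the head that is left.\<close>

lemma eval_Proj:
  assumes "has (prog (Proj i))" "i < length xs" "nums l xs"
  shows "\<exists>v. F kEval (to_nat (Proj i)) l v \<and> num v (xs ! i)"
  using assms
proof (induction i arbitrary: xs l)
  case 0
  then obtain x xs' where "xs = x # xs'" by (cases xs) auto
  with 0 show ?case by (auto elim!: nums_ConsE intro: eval_Proj0)
next
  case (Suc i)
  then obtain x xs' where xs: "xs = x # xs'" by (cases xs) auto
  with Suc.prems obtain n t where l: "F kC l n t" "nums t xs'" by (auto elim: nums_ConsE)
  have "has (prog (Proj i))" "F kProjS (to_nat (Proj (Suc i))) (to_nat (Proj i)) 0"
    using Suc.prems(1) by (auto simp: has_def)
  moreover from this Suc.IH[of xs' t] Suc.prems(2) l xs obtain v
    where "F kEval (to_nat (Proj i)) t v" "num v (xs' ! i)" by auto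
  ultimately show ?case using l xs by (auto intro: eval_ProjS)
qed

text \<open>Induction on the derivation: \<open>ex_S\<close> and \<open>ex_C\<close> supply
  representatives of the numbers and lists that occur, and then the matching evaluation rule
  fires.\<close>

lemma eval_computes:
  assumes "computes r xs y" "has (prog r)" "nums l xs"
  shows "\<exists>v. F kEval (to_nat r) l v \<and> num v y"
  using assms
proof (induction arbitrary: l rule: computes.induct)
  case (zero xs)
  then show ?case by (auto intro: eval_Zero nums_elem num_0)
next
  case (succ x)
  then obtain m where m: "F kC l m 0" "num m x"
    by (auto elim!: nums_ConsE elim: nums.cases)
  with num_elem ex_S obtain n where "F kS m n 0" by blast
  with m succ show ?case by (auto intro: eval_Succ num_Suc)
next
  case (proj i xs)
  then show ?case using eval_Proj by blast
next
  case (comp xs gs ys f z)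
  then have "has (progs gs)" by simp
  \<comment> \<open>The list of argument values is assembled from its tail by an inner
    induction.\<close>
  have "\<exists>m. F kEvals (to_nat gs) l m \<and> nums m ys"
    using comp.IH(1) \<open>has (progs gs)\<close>
  proof (induction rule: list_all2_induct)
    case Nil
    with comp.prems show ?case by (auto intro: evals_Nil nums_elem nums_Nil)
  next
    case (Cons g gs y ys)
    then obtain v t where v: "F kEval (to_nat g) l v" "num v y" and t: "F kEvals (to_nat gs) l t" "nums t ys"
      using comp.prems by auto
    with num_elem nums_elem ex_C obtain m where m: "F kC m v t" by metis
    with v t Cons.prems have "F kEvals (to_nat (g # gs)) l m"
      by (auto intro: evals_Cons)
    with m v t show ?case by (auto intro: nums_Cons)
  qed
  with comp.IH(2) comp.prems show ?case by (force intro: eval_Comp)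
next
  case (prim_0 f xs y g)
  then obtain t where t: "F kC l 0 t" "nums t xs" by (auto elim!: nums_ConsE num_0E)
  with prim_0.IH[of t] prim_0.prems obtain v where "F kEval (to_nat f) t v" "num v y" by auto
  with t prim_0.prems show ?case by (auto intro: eval_Prim0)
next
  case (prim_Suc f g n xs y z)
  then obtain u v t where l: "F kC l v t" "F kS u v 0" "num u n" "nums t xs"
    by (auto elim!: nums_ConsE num_SucE)
  with num_elem nums_elem ex_C obtain l' where l': "F kC l' u t" by metis
  \<comment> \<open>The rule needs three new list cells: \<open>l'\<close> for the recursive call,
    \<open>a\<close> for its result put before the parameters, and \<open>b\<close> for the
    arguments of the step program.\<close>
  with l have "nums l' (n # xs)" by (auto intro: nums_Cons)
  with prim_Suc obtain p where p: "F kEval (to_nat (PrimRec f g)) l' p" "num p y" by auto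
  with l num_elem nums_elem ex_C obtain a where a: "F kC a p t" by metis
  with l p have an: "nums a (y # xs)" by (auto intro: nums_Cons)
  with l num_elem nums_elem ex_C obtain b where b: "F kC b u a" by metis
  with l an have "nums b (n # y # xs)" by (auto intro: nums_Cons)
  with prim_Suc obtain w where w: "F kEval (to_nat g) b w" "num w z" by auto
  have "F kPrim (to_nat (PrimRec f g)) (to_nat f) (to_nat g)" using prim_Suc.prems by simp
  from eval_PrimS[OF this l(2,1) l' p(1) a b w(1)] w(2) show ?case by blast
next
  case (mu f n xs)
  have f: "F kMu (to_nat (Mu f)) (to_nat f) 0" using mu.prems by simp
  \<comment> \<open>The search reaches every candidate up to \<open>n\<close>, since at each earlier
    one the value is a successor, which is what \<open>try_S\<close> tests.\<close>
  have "i \<le> n \<Longrightarrow> \<exists>v. num v i \<and> F kTry (to_nat (Mu f)) l v" for i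
  proof (induction i)
    case 0
    show ?case using f mu.prems by (auto intro: try_0 nums_elem num_0)
  next
    case (Suc i)
    then obtain v where v: "num v i" "F kTry (to_nat (Mu f)) l v" by auto
    with mu.prems num_elem nums_elem ex_C obtain a where a: "F kC a v l" by metis
    with v mu.prems have "nums a (i # xs)" by (auto intro: nums_Cons)
    with mu Suc.prems obtain y w where w: "F kEval (to_nat f) a w" "num w (Suc y)"
      by (metis Suc_le_lessD prog.simps(6) has_simps(2))
    then obtain u where u: "F kS u w 0" by (auto elim: num_SucE)
    from v num_elem ex_S obtain v' where v': "F kS v v' 0" by blast
    with try_S[OF f v(2) a w(1) u v'] v show ?case by (auto intro: num_Suc)
  qed
  then obtain v where v: "num v n" "F kTry (to_nat (Mu f)) l v" by auto
  with mu.prems num_elem nums_elem ex_C obtain a where a: "F kC a v l" by metis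
  with v mu.prems have "nums a (n # xs)" by (auto intro: nums_Cons)
  with mu.IH(1)[of a] mu.prems obtain w where w: "F kEval (to_nat f) a w" "num w 0" by auto
  \<comment> \<open>\<open>eval_Mu\<close> tests for the constant \<open>0\<close>, and zero has no
    other representative.\<close>
  then have "w = 0" by (auto elim: num_0E)
  with eval_Mu[OF f v(2) a] w v show ?case by blast
qed

end

subsection \<open>Finite models of the rules\<close>

text \<open>As \<^const>\<open>computes\<close>, but all argument lists in the derivation have codes below \<open>B\<close>.\<close>

inductive bounded_computes :: "nat \<Rightarrow> recf \<Rightarrow> nat list \<Rightarrow> nat \<Rightarrow> bool" for B where
  zero: "list_encode xs < B \<Longrightarrow> bounded_computes B Zero xs 0"
| succ: "list_encode [x] < B \<Longrightarrow> bounded_computes B Succ [x] (Suc x)"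
| proj: "list_encode xs < B \<Longrightarrow> i < length xs \<Longrightarrow> bounded_computes B (Proj i) xs (xs ! i)"
| comp: "list_encode xs < B \<Longrightarrow> list_all2 (\<lambda>g y. bounded_computes B g xs y) gs ys \<Longrightarrow>
    bounded_computes B f ys z \<Longrightarrow> bounded_computes B (Comp f gs) xs z"
| prim_0: "list_encode (0 # xs) < B \<Longrightarrow> bounded_computes B f xs y \<Longrightarrow>
    bounded_computes B (PrimRec f g) (0 # xs) y"
| prim_Suc: "list_encode (Suc n # xs) < B \<Longrightarrow> bounded_computes B (PrimRec f g) (n # xs) y \<Longrightarrow>
    bounded_computes B g (n # y # xs) z \<Longrightarrow> bounded_computes B (PrimRec f g) (Suc n # xs) z"
| mu: "list_encode xs < B \<Longrightarrow> bounded_computes B f (n # xs) 0 \<Longrightarrow>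
    (\<forall>i < n. \<exists>y. bounded_computes B f (i # xs) (Suc y)) \<Longrightarrow> bounded_computes B (Mu f) xs n"

inductive_cases bounded_elims:
  "bounded_computes B Zero xs y" "bounded_computes B Succ xs y" "bounded_computes B (Proj i) xs y"
  "bounded_computes B (Comp f gs) xs y" "bounded_computes B (PrimRec f g) (0 # xs) y"
  "bounded_computes B (PrimRec f g) (Suc n # xs) y" "bounded_computes B (Mu f) xs y"

lemma bounded_computes_less: "bounded_computes B f xs y \<Longrightarrow> list_encode xs < B"
  by (erule bounded_computes.cases) auto

text \<open>A derivation contains finitely many argument lists. Stating this for all large
  \<open>B\<close> lets the bounds of subderivations combine without explicit maxima.\<close>

lemma eventually_bounded_computes:
  "computes f xs y \<Longrightarrow> \<forall>\<^sub>F B in sequentially. bounded_computes B f xs y"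
proof (induction rule: computes.induct)
  case (zero xs)
  from eventually_gt_at_top[of "list_encode xs"] show ?case
    by eventually_elim (rule bounded_computes.zero)
next
  case (succ x)
  from eventually_gt_at_top[of "list_encode [x]"] show ?case
    by eventually_elim (rule bounded_computes.succ)
next
  case (proj i xs)
  from eventually_gt_at_top[of "list_encode xs"] show ?case
    by eventually_elim (rule bounded_computes.proj[OF _ proj])
next
  case (comp xs gs ys f z)
  then have "\<forall>\<^sub>F B in sequentially. \<forall>i \<in> {..<length gs}. bounded_computes B (gs ! i) xs (ys ! i)"
    by (intro eventually_ball_finite) (auto simp: list_all2_conv_all_nth)
  with comp.IH(2) eventually_gt_at_top[of "list_encode xs"] show ?case
    by eventually_elim
      (use comp.IH(1) in \<open>auto simp: list_all2_conv_all_nth intro!: bounded_computes.comp[where ys = ys]\<close>)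
next
  case (prim_0 f xs y g)
  from prim_0.IH eventually_gt_at_top[of "list_encode (0 # xs)"] show ?case
    by eventually_elim (rule bounded_computes.prim_0)
next
  case (prim_Suc f g n xs y z)
  from prim_Suc.IH eventually_gt_at_top[of "list_encode (Suc n # xs)"] show ?case
    by eventually_elim (rule bounded_computes.prim_Suc)
next
  case (mu f n xs)
  \<comment> \<open>Fixing the values first leaves finitely many eventual statements to
    intersect.\<close>
  then obtain y where y: "\<forall>i<n. \<forall>\<^sub>F B in sequentially. bounded_computes B f (i # xs) (Suc (y i))"
    by metis
  then have "\<forall>\<^sub>F B in sequentially. \<forall>i \<in> {..<n}. bounded_computes B f (i # xs) (Suc (y i))"
    by (intro eventually_ball_finite) auto
  with mu.IH(1) eventually_gt_at_top[of "list_encode xs"] show ?case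
    by eventually_elim (auto intro: bounded_computes.mu)
qed

text \<open>
  The element \<open>B\<close> stands for every number and every list whose code is at least \<open>B\<close>. The evaluation
  facts are unconstrained on arguments without a bounded derivation, so the rules cannot fail there.
\<close>

definition truth :: "nat \<Rightarrow> recf \<Rightarrow> nat \<Rightarrow> nat \<Rightarrow> nat \<Rightarrow> nat \<Rightarrow> nat \<Rightarrow> bool" where
  "truth B h n t a b c \<longleftrightarrow>
     (t = kZero \<longrightarrow> a = to_nat Zero) \<and>
     (t = kSucc \<longrightarrow> a = to_nat Succ) \<and>
     (t = kProj0 \<longrightarrow> a = to_nat (Proj 0)) \<and>
     (t = kProjS \<longrightarrow> (\<exists>i. a = to_nat (Proj (Suc i)) \<and> b = to_nat (Proj i))) \<and>
     (t = kComp \<longrightarrow> (\<exists>f gs. a = to_nat (Comp f gs) \<and> b = to_nat f \<and> c = to_nat gs)) \<and>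
     (t = kNil \<longrightarrow> a = to_nat ([] :: recf list)) \<and>
     (t = kCons \<longrightarrow> (\<exists>g gs. a = to_nat (g # gs) \<and> b = to_nat (g :: recf) \<and> c = to_nat gs)) \<and>
     (t = kPrim \<longrightarrow> (\<exists>f g. a = to_nat (PrimRec f g) \<and> b = to_nat f \<and> c = to_nat g)) \<and>
     (t = kMu \<longrightarrow> (\<exists>f. a = to_nat (Mu f) \<and> b = to_nat f)) \<and>
     (t = kRoot \<longrightarrow> a = to_nat h) \<and>
     (t = kIn \<longrightarrow> a = n) \<and>
     (t = kS \<longrightarrow> b = min B (Suc a)) \<and>
     (t = kC \<longrightarrow> a = min B (Suc (prod_encode (b, c)))) \<and>
     (t = kEval \<longrightarrow> (\<forall>f xs y. a = to_nat f \<longrightarrow> b = list_encode xs \<longrightarrow> bounded_computes B f xs y \<longrightarrow> c = y)) \<and>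
     (t = kEvals \<longrightarrow> (\<forall>gs xs ys. a = to_nat gs \<longrightarrow> b = list_encode xs \<longrightarrow>
        list_all2 (\<lambda>g y. bounded_computes B g xs y) gs ys \<longrightarrow> list_encode ys < B \<longrightarrow> c = list_encode ys)) \<and>
     (t = kTry \<longrightarrow> (\<forall>f xs k. a = to_nat (Mu f) \<longrightarrow> b = list_encode xs \<longrightarrow>
        bounded_computes B (Mu f) xs k \<longrightarrow> c \<le> k))"

text \<open>The bounds leave finitely many rows. \<open>truth\<close> puts no condition on
  \<open>kElem\<close>, so every number up to \<open>B\<close> is an element.\<close>

definition model :: "nat \<Rightarrow> recf \<Rightarrow> nat \<Rightarrow> nat \<Rightarrow> nat \<Rightarrow> nat \<Rightarrow> nat \<Rightarrow> bool" where
  "model B h n t a b c \<longleftrightarrow> t < 18 \<and> a \<le> B \<and> b \<le> B \<and> c \<le> B \<and> truth B h n t a b c"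

lemma model_EvalD:
  "model B h n kEval (to_nat f) (list_encode xs) v \<Longrightarrow> bounded_computes B f xs y \<Longrightarrow> v = y"
  by (simp add: model_def truth_def)

lemma list_encode_Cons_less: "n < list_encode (n # ns)" "list_encode ns < list_encode (n # ns)"
  by (simp_all add: less_Suc_eq_le le_prod_encode_1 le_prod_encode_2)

text \<open>A code below \<open>B\<close> cannot be the cut-off value, so the minimum is the exact
  code of a cons cell.\<close>

lemma saturated_Cons:
  assumes "list_encode xs < B" "list_encode xs = min B (Suc (prod_encode (n, t)))"
  obtains ns where "xs = n # ns" "t = list_encode ns"
proof -
  have "list_encode xs = list_encode (n # list_decode t)" using assms by simp
  then have "xs = n # list_decode t" unfolding list_encode_eq .
  then show ?thesis by (rule that) simp
qed

text \<open>An evaluation rule could fail only if its conclusion contradicted a bounded derivation.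
  Inverting that derivation bounds the derivations behind the premises, whose values are then the
  true ones, and so is the conclusion. Positivity of \<open>B\<close> keeps \<open>0\<close> from
  being a successor.\<close>

lemma eval_closed_model:
  assumes "0 < B"
  shows "eval_closed (model B h n)"
proof
  note [simp] = model_def truth_def
  let ?F = "model B h n"
  have evalI: "?F kEval (to_nat f) l v"
    if "to_nat f \<le> B" "l \<le> B" "v \<le> B" "\<And>xs y. l = list_encode xs \<Longrightarrow> bounded_computes B f xs y \<Longrightarrow> v = y" for f l v
    using that by simp
  show "?F kElem 0 0 0" by simp
  show "?F kElem n 0 0" if "?F kS m n 0" for m n using that by simp
  show "?F kElem l 0 0" if "?F kC l n t" for l n t using that by simp
  show "\<exists>n. ?F kS m n 0" if "?F kElem m 0 0" for m using that by simp
  show "\<exists>l. ?F kC l n t" if "?F kElem n 0 0" "?F kElem t 0 0" for n t using that by simp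
  show "?F kEval f l 0" if "?F kZero f 0 0" "?F kElem l 0 0" for f l
    using that by (auto elim: bounded_elims)
  show "?F kEval f l n" if F: "?F kSucc f 0 0" "?F kC l m 0" "?F kS m n 0" for f l m n
  proof -
    have "n = y" if y: "list_encode xs = min B (Suc (prod_encode (m, 0)))" "bounded_computes B Succ xs y" for xs y
    proof -
      from saturated_Cons[OF bounded_computes_less[OF y(2)] y(1)] obtain ns
        where xs: "xs = m # ns" by metis
      with y(2) have "y = Suc m" by (auto elim: bounded_elims)
      moreover have "m < list_encode xs" using xs list_encode_Cons_less by simp
      ultimately show "n = y" using F(3) bounded_computes_less[OF y(2)] by simp
    qed
    with F show ?thesis by auto
  qed
  show "?F kEval f l n" if F: "?F kProj0 f 0 0" "?F kC l n t" for f l n t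
  proof -
    have "n = y" if y: "list_encode xs = min B (Suc (prod_encode (n, t)))" "bounded_computes B (Proj 0) xs y" for xs y
    proof -
      from saturated_Cons[OF bounded_computes_less[OF y(2)] y(1)] obtain ns
        where "xs = n # ns" by metis
      with y(2) show ?thesis by (auto elim: bounded_elims)
    qed
    with F show ?thesis by auto
  qed
  show "?F kEval f l v" if F: "?F kProjS f g 0" "?F kC l n t" "?F kEval g t v" for f g l n t v
  proof -
    obtain i where i: "f = to_nat (Proj (Suc i))" "g = to_nat (Proj i)" using F(1) by auto
    have "v = y" if y: "list_encode xs = min B (Suc (prod_encode (n, t)))" "bounded_computes B (Proj (Suc i)) xs y" for xs y
    proof -
      note less = bounded_computes_less[OF y(2)]
      from saturated_Cons[OF less y(1)] obtain ns
        where ns: "xs = n # ns" "t = list_encode ns" by metis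
      with y(2) have "y = ns ! i" "i < length ns" by (auto elim: bounded_elims)
      then have "bounded_computes B (Proj i) ns y"
        using less ns list_encode_Cons_less(2)[of ns n] by (auto intro!: bounded_computes.proj)
      with F(3) i ns show ?thesis by auto
    qed
    with F i show ?thesis by auto
  qed
  show "?F kEvals gs l 0" if "?F kNil gs 0 0" "?F kElem l 0 0" for gs l
    using that by auto
  show "?F kEvals gs l m" if F: "?F kCons gs g hs" "?F kEval g l v" "?F kEvals hs l t" "?F kC m v t" for gs g hs l v t m
  proof -
    obtain r rs where r: "gs = to_nat (r # rs)" "g = to_nat r" "hs = to_nat (rs :: recf list)" using F(1) by auto
    have "m = list_encode ys" if y: "l = list_encode xs" "list_encode ys < B"
      "list_all2 (\<lambda>g y. bounded_computes B g xs y) (r # rs) ys" for xs ys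
    proof -
      from y obtain z zs where z: "ys = z # zs" "bounded_computes B r xs z"
        "list_all2 (\<lambda>g y. bounded_computes B g xs y) rs zs" by (auto simp: list_all2_Cons1)
      \<comment> \<open>The clause for \<open>kEvals\<close> speaks only of result lists below
        \<open>B\<close>; tails inherit the bound because their codes are smaller.\<close>
      have "list_encode zs < B" using y(2) z(1) list_encode_Cons_less(2)[of zs z] by simp
      with F(2,3) r y(1) z have "v = z" "t = list_encode zs" by auto
      with F(4) y z(1) show ?thesis by simp
    qed
    with F r show ?thesis by auto
  qed
  show "?F kEval f l v" if F: "?F kComp f g gs" "?F kEvals gs l m" "?F kEval g m v" for f g gs l m v
  proof -
    obtain r rs where r: "f = to_nat (Comp r rs)" "g = to_nat r" "gs = to_nat rs" using F(1) by auto
    have "v = y" if y: "l = list_encode xs" "bounded_computes B (Comp r rs) xs y" for xs y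
    proof -
      from y(2) obtain ys where ys: "list_all2 (\<lambda>g y. bounded_computes B g xs y) rs ys" "bounded_computes B r ys y"
        by (auto elim: bounded_elims)
      with F(2) r y bounded_computes_less[OF ys(2)] have "m = list_encode ys" by auto
      with F(3) r ys show ?thesis by auto
    qed
    with F r show ?thesis by auto
  qed
  show "?F kEval f l v" if F: "?F kPrim f g h" "?F kC l 0 t" "?F kEval g t v" for f g h l t v
  proof -
    obtain r s where r: "f = to_nat (PrimRec r s)" "g = to_nat r" "h = to_nat s" using F(1) by auto
    have "v = y" if y: "list_encode xs = min B (Suc (prod_encode (0, t)))" "bounded_computes B (PrimRec r s) xs y" for xs y
    proof -
      from saturated_Cons[OF bounded_computes_less[OF y(2)] y(1)] obtain ns
        where ns: "xs = 0 # ns" "t = list_encode ns" by metis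
      with y(2) have "bounded_computes B r ns y" by (auto elim: bounded_elims)
      with F(3) r ns show ?thesis by auto
    qed
    with F r show ?thesis by auto
  qed
  show "?F kEval f l w" if F: "?F kPrim f g h" "?F kS m n 0" "?F kC l n t" "?F kC l' m t" "?F kEval f l' v"
    "?F kC a v t" "?F kC b m a" "?F kEval h b w" for f g h m n l t l' v a b w
  proof -
    obtain r s where r: "f = to_nat (PrimRec r s)" "g = to_nat r" "h = to_nat s" using F(1) by auto
    have "w = y" if y: "l = list_encode xs" "bounded_computes B (PrimRec r s) xs y" for xs y
    proof -
      note less = bounded_computes_less[OF y(2)]
      have "list_encode xs = min B (Suc (prod_encode (n, t)))" using F(3) y(1) by simp
      from saturated_Cons[OF less this] obtain ns
        where ns: "xs = n # ns" "t = list_encode ns" by metis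
      \<comment> \<open>A head is smaller than the code of its list, so the successor row for
        \<open>n\<close> is not cut off.\<close>
      have "n < B" using less ns list_encode_Cons_less(1)[of n ns] by simp
      with F(2) have n: "n = Suc m" by (simp add: min_def split: if_splits)
      from y(2) obtain z where z: "bounded_computes B (PrimRec r s) (m # ns) z" "bounded_computes B s (m # z # ns) y"
        unfolding ns n by (auto elim: bounded_elims)
      have "l' = list_encode (m # ns)" using F(4) ns bounded_computes_less[OF z(1)] by simp
      with F(5) r z(1) have v: "v = z" by (metis model_EvalD)
      have "a = list_encode (z # ns)"
        using F(6) ns v bounded_computes_less[OF z(2)] list_encode_Cons_less(2)[of "z # ns" m] by simp
      then have "b = list_encode (m # z # ns)" using F(7) bounded_computes_less[OF z(2)] by simp
      with F(8) r z(2) show ?thesis by (metis model_EvalD)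
    qed
    moreover have "f \<le> B" "l \<le> B" "w \<le> B" using F(5,3,8) by simp_all
    ultimately show ?thesis unfolding r by (intro evalI)
  qed
  show "?F kTry f l 0" if "?F kMu f g 0" "?F kElem l 0 0" for f g l
    using that by auto
  show "?F kTry f l n" if F: "?F kMu f g 0" "?F kTry f l m" "?F kC a m l" "?F kEval g a v" "?F kS u v 0" "?F kS m n 0"
    for f g l m a v u n
  proof -
    obtain r where r: "f = to_nat (Mu r)" "g = to_nat r" using F(1) by auto
    have "n \<le> k" if y: "l = list_encode xs" "bounded_computes B (Mu r) xs k" for xs k
    proof -
      from y(2) have k: "bounded_computes B r (k # xs) 0" by (auto elim: bounded_elims)
      have "m \<le> k" using F(2) r y by auto
      \<comment> \<open>The search cannot pass the answer \<open>k\<close>: there the value is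
        \<open>0\<close>, whereas the premise makes \<open>v\<close> a successor.\<close>
      moreover have "m \<noteq> k"
      proof
        assume "m = k"
        with F(3) y(1) bounded_computes_less[OF k] have "a = list_encode (k # xs)" by simp
        with F(4) r k have "v = 0" by (metis model_EvalD)
        with F(5) assms show False by (auto simp: min_def split: if_splits)
      qed
      ultimately show ?thesis using F(6) by simp
    qed
    with F r show ?thesis by auto
  qed
  show "?F kEval f l m" if F: "?F kMu f g 0" "?F kTry f l m" "?F kC a m l" "?F kEval g a 0" for f g l m a
  proof -
    obtain r where r: "f = to_nat (Mu r)" "g = to_nat r" using F(1) by auto
    have "m = k" if y: "l = list_encode xs" "bounded_computes B (Mu r) xs k" for xs k
    \<comment> \<open>Below the true answer the value is positive, so the search cannot stop
      there.\<close>
    proof (rule ccontr)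
      assume "m \<noteq> k"
      moreover have "m \<le> k" using F(2) r y by auto
      moreover have "\<forall>i<k. \<exists>z. bounded_computes B r (i # xs) (Suc z)"
        using y(2) by (auto elim: bounded_elims)
      ultimately obtain z where z: "bounded_computes B r (m # xs) (Suc z)"
        by (metis le_neq_implies_less)
      with F(3) y(1) bounded_computes_less[OF z] have "a = list_encode (m # xs)" by simp
      with F(4) r z show False by (metis model_EvalD nat.distinct(1))
    qed
    with F r show ?thesis by auto
  qed
qed

text \<open>Program rows hold in the model for every choice of parameters. The bound on the tags
  separates them from the root and input rows.\<close>

lemma prog_truth:
  "x \<in> prog f \<Longrightarrow> \<exists>t a b c. x = [t, a, b, c] \<and> t < 10 \<and> (\<forall>B h n. truth B h n t a b c)"
  "x \<in> progs fs \<Longrightarrow> \<exists>t a b c. x = [t, a, b, c] \<and> t < 10 \<and> (\<forall>B h n. truth B h n t a b c)"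
  by (induction f and fs rule: prog_progs.induct) (auto simp: truth_def)

lemma finite_prog: "finite (prog f)" "finite (progs fs)"
  by (induction f and fs rule: prog_progs.induct) auto

subsection \<open>The procedure\<close>

definition db_schema :: schema where
  "db_schema = [Rel 0 \<mapsto> Attr ` {..<18}, Rel 1 \<mapsto> Attr ` {..<4}]"

definition db_of :: "nat list set \<Rightarrow> db" where
  "db_of X = DB db_schema ((\<lambda>_. {})(Rel 0 := {consts}, Rel 1 := row ` X))"

definition fact :: "db \<Rightarrow> nat \<Rightarrow> nat \<Rightarrow> nat \<Rightarrow> nat \<Rightarrow> bool" where
  "fact I t a b c \<longleftrightarrow> (\<exists>r \<in> ext I (Rel 1). r (Attr 0) = Some (Val t) \<and> r (Attr 1) = Some (Val a) \<and>
     r (Attr 2) = Some (Val b) \<and> r (Attr 3) = Some (Val c))"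

definition fact_atom :: "nat \<times> nat \<times> nat \<times> nat \<Rightarrow> named_atom" where
  "fact_atom = (\<lambda>(t, x, y, z). Atom (Rel 1) [(Attr 0, t), (Attr 1, x), (Attr 2, y), (Attr 3, z)])"

definition const_atom :: named_atom where
  "const_atom = Atom (Rel 0) (map (\<lambda>i. (Attr i, i)) [0..<18])"

definition tgd :: "conj \<Rightarrow> conj \<Rightarrow> constraint" where
  "tgd \<phi> \<psi> = Tgd [x \<leftarrow> concat (map (map snd \<circ> atom_args) \<phi>). x \<in> conj_vars \<psi>] \<phi> \<psi>"

text \<open>The variables 18 to 21 stand for the root program, the input, the one-element list of
  the input, and a successor of zero.\<close>

definition goal :: pattern where
  "goal = [(kRoot,18,0,0), (kIn,19,0,0), (kC,20,19,0), (kS,0,21,0), (kEval,18,20,21)]"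

text \<open>
  The first tgd is the denial: its head asks for \<open>Val 1\<close> in the first column of \<open>Rel 0\<close>, which holds
  \<open>Val 0\<close> in every outcome.
\<close>

definition eval_proc :: proc where
  "eval_proc = Proc {Whole (Rel 1)} {}
     (insert (tgd (const_atom # map fact_atom goal) [Atom (Rel 0) [(Attr 0, 1)]])
       ((\<lambda>(b, h). tgd (const_atom # map fact_atom b) (const_atom # map fact_atom h)) ` set rules))
     {CQ [0, 1, 2, 3] [fact_atom (0, 1, 2, 3)]}"

section \<open>Meaning of the postconditions\<close>

lemma constraint_wf_tgd: "conj_wf \<phi> \<Longrightarrow> conj_wf \<psi> \<Longrightarrow> constraint_wf (tgd \<phi> \<psi>)"
  by (auto simp: tgd_def conj_vars_def)

lemma holds_tgd_iff:
  "constraint_holds I (tgd \<phi> \<psi>) \<longleftrightarrow> (\<forall>\<tau>. conj_sat I \<tau> \<phi> \<longrightarrow>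
     (\<exists>\<sigma>. (\<forall>x \<in> conj_vars \<phi> \<inter> conj_vars \<psi>. \<sigma> x = \<tau> x) \<and> conj_sat I \<sigma> \<psi>))"
proof -
  have "set [x \<leftarrow> concat (map (map snd \<circ> atom_args) \<phi>). x \<in> conj_vars \<psi>] = conj_vars \<phi> \<inter> conj_vars \<psi>"
    by (auto simp: conj_vars_def)
  then show ?thesis
    unfolding tgd_def constraint_holds.simps cq_sat_def by metis
qed

lemma atom_wf_simps [simp]: "atom_wf (fact_atom p)" "atom_wf const_atom" "atom_wf (Atom R [(A, x)])"
  by (auto simp: fact_atom_def const_atom_def atom_wf_def comp_def inj_on_def distinct_map split: prod.splits)

lemma atom_compatible_simps [simp]:
  "atom_compatible db_schema (fact_atom p)" "atom_compatible db_schema const_atom"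
  "atom_compatible db_schema (Atom (Rel 0) [(Attr 0, x)])"
  by (auto simp: fact_atom_def const_atom_def atom_compatible_def db_schema_def split: prod.splits)

lemma proc_wf_eval_proc: "proc_wf eval_proc"
  by (auto simp: proc_wf_def eval_proc_def conj_wf_def intro!: constraint_wf_tgd)
    (auto simp: conj_vars_def fact_atom_def)

lemma sat_fact_atom:
  "atom_sat I \<tau> (fact_atom (t, x, y, z)) \<longleftrightarrow>
    fact I (val_idx (\<tau> t)) (val_idx (\<tau> x)) (val_idx (\<tau> y)) (val_idx (\<tau> z))"
  by (simp add: atom_sat_def fact_atom_def fact_def)

lemma conj_sat_fact_atoms:
  "conj_sat I \<tau> (map fact_atom b) \<longleftrightarrow> pattern_sat (fact I) (val_idx \<circ> \<tau>) b"
  by (auto simp: conj_sat_def pattern_sat_def sat_fact_atom)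

lemma sat_const_atom:
  assumes "ext I (Rel 0) = {consts}"
  shows "atom_sat I \<tau> const_atom \<longleftrightarrow> (\<forall>i<18. \<tau> i = Val i)"
  using assms by (auto simp: atom_sat_def const_atom_def row_def)

lemma vars_rule_body: "conj_vars (const_atom # map fact_atom b) = {..<18} \<union> pattern_vars b"
  by (auto simp: conj_vars_def pattern_vars_def fact_atom_def const_atom_def image_image split: prod.splits)

lemma holds_rule_iff:
  assumes K: "ext I (Rel 0) = {consts}"
  shows "constraint_holds I (tgd (const_atom # map fact_atom b) (const_atom # map fact_atom h)) \<longleftrightarrow>
    satisfies (fact I) b h"
proof -
  have sat: "conj_sat I \<tau> (const_atom # map fact_atom b) \<longleftrightarrow>
      (\<forall>i<18. \<tau> i = Val i) \<and> pattern_sat (fact I) (val_idx \<circ> \<tau>) b" for \<tau> b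
    using conj_sat_fact_atoms[of I \<tau> b] sat_const_atom[OF K] by (simp add: conj_sat_def)
  \<comment> \<open>\<open>Val\<close> is a bijection, so quantifiers over valuations become
    quantifiers over functions on numbers.\<close>
  have all: "(\<forall>\<tau>. P (\<tau> :: nat \<Rightarrow> val)) \<longleftrightarrow> (\<forall>e. P (Val \<circ> e))" for P
  proof -
    have "\<tau> = Val \<circ> (val_idx \<circ> \<tau>)" for \<tau> :: "nat \<Rightarrow> val" by auto
    then show ?thesis by metis
  qed
  have ex: "(\<exists>\<tau>. P (\<tau> :: nat \<Rightarrow> val)) \<longleftrightarrow> (\<exists>e. P (Val \<circ> e))" for P
    using all[of "\<lambda>\<tau>. \<not> P \<tau>"] by blast
  have idx: "val_idx \<circ> (Val \<circ> e) = e" for e by auto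
  \<comment> \<open>Agreement on the variables below 18 is automatic, as the constants atom pins
    them on both sides.\<close>
  have key: "(\<forall>x \<in> ({..<18} \<union> V) \<inter> ({..<18} \<union> W). d x = e x) \<and> (\<forall>i<18. d i = i) \<and> Q \<longleftrightarrow>
      (\<forall>x \<in> V. x \<in> W \<longrightarrow> d x = e x) \<and> (\<forall>i<18. d i = i) \<and> Q"
    if "\<forall>i<18. e i = i" for V W Q and d e :: "nat \<Rightarrow> nat"
    using that by (metis IntD1 IntD2 IntI UnE UnI2 lessThan_iff)
  show ?thesis
    unfolding holds_tgd_iff all ex vars_rule_body sat satisfies_def idx comp_apply val.inject
    by (intro iff_allI) (simp add: key imp_conjL cong: imp_cong)
qed

text \<open>Variable 1 occurs in the constants atom, so it is shared and keeps the value
  \<open>Val 1\<close> in the head, which the only row of \<open>Rel 0\<close> refutes.\<close>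

lemma holds_goal_iff:
  assumes K: "ext I (Rel 0) = {consts}"
  shows "constraint_holds I (tgd (const_atom # map fact_atom goal) [Atom (Rel 0) [(Attr 0, 1)]]) \<longleftrightarrow>
    \<not> (\<exists>p n l m. fact I kRoot p 0 0 \<and> fact I kIn n 0 0 \<and> fact I kC l n 0 \<and> fact I kS 0 m 0 \<and> fact I kEval p l m)"
    (is "_ \<longleftrightarrow> \<not> (\<exists>p n l m. ?G p n l m)")
proof -
  have sat: "conj_sat I \<tau> (const_atom # map fact_atom goal) \<longleftrightarrow>
      (\<forall>i<18. \<tau> i = Val i) \<and> ?G (val_idx (\<tau> 18)) (val_idx (\<tau> 19)) (val_idx (\<tau> 20)) (val_idx (\<tau> 21))" for \<tau>
    using conj_sat_fact_atoms[of I \<tau> goal] sat_const_atom[OF K]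
    by (auto simp: conj_sat_def goal_def pattern_sat_def)
  have vars: "1 \<in> conj_vars (const_atom # map fact_atom goal) \<inter> conj_vars [Atom (Rel 0) [(Attr 0, 1)]]"
    unfolding vars_rule_body by (simp add: conj_vars_def)
  have no: "\<not> conj_sat I \<sigma> [Atom (Rel 0) [(Attr 0, 1)]]" if "\<sigma> 1 = Val 1" for \<sigma>
    using that K by (simp add: conj_sat_def atom_sat_def row_def)
  show ?thesis
  proof
    assume H: "constraint_holds I (tgd (const_atom # map fact_atom goal) [Atom (Rel 0) [(Attr 0, 1)]])"
    show "\<not> (\<exists>p n l m. ?G p n l m)"
    proof
      assume "\<exists>p n l m. ?G p n l m"
      then obtain p n l m where G: "?G p n l m" by blast
      define \<tau> where "\<tau> i = Val (if i < 18 then i else [p, n, l, m] ! (i - 18))" for i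
      have \<tau>: "\<forall>i<18. \<tau> i = Val i" by (simp add: \<tau>_def)
      moreover have "?G (val_idx (\<tau> 18)) (val_idx (\<tau> 19)) (val_idx (\<tau> 20)) (val_idx (\<tau> 21))"
        using G by (simp add: \<tau>_def)
      ultimately have "conj_sat I \<tau> (const_atom # map fact_atom goal)" unfolding sat by blast
      with H obtain \<sigma> where "\<sigma> 1 = \<tau> 1" "conj_sat I \<sigma> [Atom (Rel 0) [(Attr 0, 1)]]"
        unfolding holds_tgd_iff using vars by blast
      with no \<tau> show False by simp
    qed
  next
    assume "\<not> (\<exists>p n l m. ?G p n l m)"
    then show "constraint_holds I (tgd (const_atom # map fact_atom goal) [Atom (Rel 0) [(Attr 0, 1)]])"
      unfolding holds_tgd_iff sat by blast
  qed
qed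

lemma models_post_iff:
  assumes "schema I = db_schema" "ext I (Rel 0) = {consts}"
  shows "models I (post eval_proc) \<longleftrightarrow> eval_closed (fact I) \<and>
    \<not> (\<exists>p n l m. fact I kRoot p 0 0 \<and> fact I kIn n 0 0 \<and> fact I kC l n 0 \<and> fact I kS 0 m 0 \<and> fact I kEval p l m)"
proof -
  have "constraint_compatible (schema I) c" if "c \<in> post eval_proc" for c
    using that assms(1) by (auto simp: eval_proc_def tgd_def conj_compatible_def)
  then have "models I (post eval_proc) \<longleftrightarrow> (\<forall>c \<in> post eval_proc. constraint_holds I c)"
    by (auto simp: models_def)
  also have "\<dots> \<longleftrightarrow> (\<forall>(b, h) \<in> set rules. satisfies (fact I) b h) \<and>
    \<not> (\<exists>p n l m. fact I kRoot p 0 0 \<and> fact I kIn n 0 0 \<and> fact I kC l n 0 \<and> fact I kS 0 m 0 \<and> fact I kEval p l m)"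
    unfolding eval_proc_def proc.sel ball_simps holds_goal_iff[OF assms(2)]
    by (auto simp: holds_rule_iff[OF assms(2)] split_beta)
  finally show ?thesis unfolding satisfies_rules_iff .
qed

section \<open>Instances given by sets of rows\<close>

definition rows4 :: "nat list set \<Rightarrow> bool" where
  "rows4 X \<longleftrightarrow> finite X \<and> (\<forall>x \<in> X. length x = 4)"

lemma row_inject: "row xs = row ys \<longleftrightarrow> xs = ys"
proof
  assume eq: "row xs = row ys"
  have *: "row zs (Attr i) = (if i < length zs then Some (Val (zs ! i)) else None)" for zs i
    by (simp add: row_def)
  have "i < length xs \<longleftrightarrow> i < length ys" for i
    using fun_cong[OF eq, of "Attr i"] unfolding * by (metis option.distinct(1))
  then have len: "length xs = length ys" by (metis nat_neq_iff)
  moreover have "xs ! i = ys ! i" if "i < length xs" for i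
    using fun_cong[OF eq, of "Attr i"] that len unfolding * by simp
  ultimately show "xs = ys" by (rule nth_equalityI)
qed simp

lemma dom_row: "dom (row xs) = Attr ` {..<length xs}"
proof -
  have "A \<in> Attr ` {..<n} \<longleftrightarrow> attr_idx A < n" for A n by (cases A) auto
  then show ?thesis by (auto simp: row_def split: if_splits)
qed

lemma db_wf_db_of: "rows4 X \<Longrightarrow> db_wf (db_of X)"
  by (auto simp: db_wf_def schema_wf_def db_of_def db_schema_def dom_row rows4_def)

lemma schema_db_of [simp]: "schema (db_of X) = db_schema"
  and ext_db_of: "ext (db_of X) (Rel 0) = {consts}" "ext (db_of X) (Rel 1) = row ` X"
  by (simp_all add: db_of_def)

lemma fact_db_of: "rows4 X \<Longrightarrow> fact (db_of X) t a b c \<longleftrightarrow> [t, a, b, c] \<in> X"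
proof -
  assume X: "rows4 X"
  have "fact (db_of X) t a b c \<longleftrightarrow> (\<exists>x \<in> X. x = [t, a, b, c])"
    unfolding fact_def ext_db_of bex_simps
  proof (intro bex_cong refl)
    fix x assume "x \<in> X"
    with X have "length x = Suc (Suc (Suc (Suc 0)))" by (simp add: rows4_def)
    then obtain p q r s where "x = [p, q, r, s]" by (auto simp: length_Suc_conv)
    then show "(row x (Attr 0) = Some (Val t) \<and> row x (Attr 1) = Some (Val a) \<and> row x (Attr 2) = Some (Val b) \<and>
      row x (Attr 3) = Some (Val c)) = (x = [t, a, b, c])" by (simp add: row_def)
  qed
  then show ?thesis by simp
qed

text \<open>The query returns all four columns, so preserving its answers preserves every initial
  fact.\<close>

lemma answers_fact:
  "answers (CQ [0, 1, 2, 3] [fact_atom (0, 1, 2, 3)]) I = {[Val t, Val a, Val b, Val c] |t a b c. fact I t a b c}"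
    (is "?L = ?R")
proof
  show "?L \<subseteq> ?R"
  proof
    fix v assume "v \<in> ?L"
    then obtain \<tau> \<sigma> where v: "v = map \<tau> [0, 1, 2, 3]" "\<forall>y \<in> set [0, 1, 2, 3]. \<sigma> y = \<tau> y"
      "conj_sat I \<sigma> [fact_atom (0, 1, 2, 3)]" by (auto simp: cq_sat_def)
    then show "v \<in> ?R"
      by (intro CollectI exI[of _ "val_idx (\<tau> 0)"] exI[of _ "val_idx (\<tau> 1)"] exI[of _ "val_idx (\<tau> 2)"]
          exI[of _ "val_idx (\<tau> 3)"]) (simp add: conj_sat_def sat_fact_atom)
  qed
  show "?R \<subseteq> ?L"
  proof
    fix v assume "v \<in> ?R"
    then obtain t a b c where v: "v = [Val t, Val a, Val b, Val c]" "fact I t a b c" by blast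
    define \<tau> where "\<tau> i = [Val t, Val a, Val b, Val c] ! i" for i
    have "v = map \<tau> [0, 1, 2, 3]" "cq_sat I \<tau> [0, 1, 2, 3] [fact_atom (0, 1, 2, 3)]"
      using v by (auto simp: \<tau>_def cq_sat_def conj_sat_def sat_fact_atom intro!: exI[of _ \<tau>])
    then show "v \<in> ?L" by auto
  qed
qed

text \<open>\<open>Rel 0\<close> lies outside the scope and is fixed; \<open>Rel 1\<close> lies
  wholly inside it, so only the preserved query ties it to the initial rows.\<close>

lemma outcomes_iff:
  assumes "rows4 X"
  shows "J \<in> outcomes eval_proc (db_of X) \<longleftrightarrow> db_wf J \<and> schema J = db_schema \<and> ext J (Rel 0) = {consts} \<and>
    (\<forall>t a b c. [t, a, b, c] \<in> X \<longrightarrow> fact J t a b c) \<and> models J (post eval_proc)"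
proof -
  have "agree_outside_scope eval_proc (db_of X) J \<longleftrightarrow> ext J (Rel 0) = {consts}"
    by (auto simp: agree_outside_scope_def eval_proc_def db_of_def db_schema_def split: if_splits)
  moreover have "pre eval_proc = {}" "pres eval_proc = {CQ [0, 1, 2, 3] [fact_atom (0, 1, 2, 3)]}"
    by (simp_all add: eval_proc_def)
  moreover have "answers (CQ [0, 1, 2, 3] [fact_atom (0, 1, 2, 3)]) (db_of X) \<subseteq>
      answers (CQ [0, 1, 2, 3] [fact_atom (0, 1, 2, 3)]) J \<longleftrightarrow> (\<forall>t a b c. [t, a, b, c] \<in> X \<longrightarrow> fact J t a b c)"
    (is "?L \<subseteq> ?R \<longleftrightarrow> _")
  proof (intro iffI allI impI)
    fix t a b c assume "?L \<subseteq> ?R" "[t, a, b, c] \<in> X"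
    then have "[Val t, Val a, Val b, Val c] \<in> ?R" unfolding answers_fact fact_db_of[OF assms] by blast
    then show "fact J t a b c" unfolding answers_fact by simp
  next
    assume "\<forall>t a b c. [t, a, b, c] \<in> X \<longrightarrow> fact J t a b c"
    then show "?L \<subseteq> ?R" unfolding answers_fact fact_db_of[OF assms] by blast
  qed
  ultimately show ?thesis
    unfolding outcomes_def applicable_def
    by (simp add: conj_compatible_def models_def[of _ "{}"] del: answers.simps) metis
qed

subsection \<open>Undecidability\<close>

definition row_code :: "nat list \<Rightarrow> nat" where
  "row_code xs = tuple_code (row xs)"

lemma inj_row_code: "inj row_code"
  unfolding row_code_def
  by (intro injI) (metis dom_row finite_imageI finite_lessThan row_inject tuple_code_inj)

lemma row_code_eq: "row_code xs = (\<Sum>i<length xs. 2 ^ prod_encode (i, xs ! i))"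
proof -
  have "{prod_encode (attr_idx A, val_idx v) |A v. row xs A = Some v} =
      (\<lambda>i. prod_encode (i, xs ! i)) ` {..<length xs}" (is "?L = ?R")
  proof
    show "?L \<subseteq> ?R" by (auto simp: row_def split: if_splits)
    show "?R \<subseteq> ?L"
    proof
      fix p assume "p \<in> ?R"
      then obtain i where "p = prod_encode (attr_idx (Attr i), val_idx (Val (xs ! i)))" "i < length xs" by auto
      moreover from this have "row xs (Attr i) = Some (Val (xs ! i))" by (simp add: row_def)
      ultimately show "p \<in> ?L" by blast
    qed
  qed
  then show ?thesis
    unfolding row_code_def tuple_code_def set_encode_def
    by (simp add: sum.reindex inj_on_def)
qed

text \<open>By injectivity of \<open>row_code\<close> this is \<open>set_encode\<close> of the tuple
  codes. As a sum it splits over disjoint sets of rows.\<close>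

definition rows_code :: "nat list set \<Rightarrow> nat" where
  "rows_code X = (\<Sum>x\<in>X. 2 ^ row_code x)"

text \<open>Only the contents of \<open>Rel 1\<close> vary with \<open>X\<close>: \<open>c\<close>
  codes all of \<open>Rel 0\<close>, and \<open>s\<close> the columns of
  \<open>Rel 1\<close>.\<close>

lemma db_code_db_of:
  obtains c s where "\<And>X. db_code (db_of X) = 2 ^ c + 2 ^ prod_encode (1, prod_encode (s, rows_code X))"
proof
  let ?s = "set_encode (attr_idx ` Attr ` {..<4})" and ?c = "rel_code (db_of {}) (Rel 0)"
  fix X
  have "set_encode (tuple_code ` row ` X) = rows_code X"
    unfolding set_encode_def rows_code_def image_image row_code_def[symmetric]
    by (simp add: sum.reindex inj_on_subset[OF inj_row_code])
  then have "rel_code (db_of X) (Rel 1) = prod_encode (1, prod_encode (?s, rows_code X))"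
    by (simp add: rel_code_def db_of_def db_schema_def)
  moreover have "rel_code (db_of X) (Rel 0) = ?c" by (simp add: rel_code_def db_of_def)
  \<comment> \<open>Distinct relation codes ensure that the binary expansion has two separate
    summands.\<close>
  moreover from calculation have "rel_code (db_of X) (Rel 0) \<noteq> rel_code (db_of X) (Rel 1)"
    by (simp add: rel_code_def)
  moreover have "dom (schema (db_of X)) = {Rel 0, Rel 1}"
    by (auto simp: db_of_def db_schema_def)
  ultimately show "db_code (db_of X) = 2 ^ ?c + 2 ^ prod_encode (1, prod_encode (?s, rows_code X))"
    by (simp add: db_code_def set_encode_def)
qed

text \<open>The successor rows make the element \<open>n\<close> represent the number
  \<open>n\<close> in every outcome.\<close>

definition input_rows :: "nat \<Rightarrow> nat list set" where
  "input_rows n = insert [kIn, n, 0, 0] ((\<lambda>i. [kS, i, Suc i, 0]) ` {..<n})"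

definition root_rows :: "recf \<Rightarrow> nat list set" where
  "root_rows h = insert [kRoot, to_nat h, 0, 0] (prog h)"

text \<open>The tags differ, so the two sets are disjoint. The program enters only through the
  summand \<open>rows_code (root_rows h)\<close>.\<close>

lemma rows_code_input:
  "rows_code (root_rows h \<union> input_rows n) =
     rows_code (root_rows h) + (2 ^ row_code [kIn, n, 0, 0] + (\<Sum>i<n. 2 ^ row_code [kS, i, Suc i, 0]))"
proof -
  have fin: "finite (root_rows h)" "finite (input_rows n)"
    by (simp_all add: root_rows_def input_rows_def finite_prog)
  have "root_rows h \<inter> input_rows n = {}"
    by (auto simp: root_rows_def input_rows_def dest: prog_truth(1))
  then have "rows_code (root_rows h \<union> input_rows n) = rows_code (root_rows h) + rows_code (input_rows n)"
    unfolding rows_code_def by (rule sum.union_disjoint[OF fin])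
  also have "rows_code (input_rows n) = 2 ^ row_code [kIn, n, 0, 0] + (\<Sum>i<n. 2 ^ row_code [kS, i, Suc i, 0])"
    unfolding rows_code_def input_rows_def
    by (subst sum.insert) (auto simp: sum.reindex inj_on_def)
  finally show ?thesis .
qed

text \<open>One \<open>r\<close> serves all \<open>h\<close>: its argument \<open>n\<close> is
  already the summand contributed by the program, and the rest is recursive in
  \<open>n\<close>.\<close>

lemma recursive_db_code:
  assumes "\<And>X. db_code (db_of X) = 2 ^ c + 2 ^ prod_encode (1, prod_encode (s, rows_code X))"
  obtains r where "\<And>h. computes r [rows_code (root_rows h)]
    (db_code (db_of (root_rows h \<union> input_rows (rows_code (root_rows h)))))"
proof -
  have id: "recursive_on (\<lambda>n. [n]) (\<lambda>n. n)" by (rule recursive_on_proj[of 0]) auto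
  have row: "recursive_on (\<lambda>n. [n]) (\<lambda>n. row_code [t, f n, g n, 0])"
    if "recursive_on (\<lambda>n. [n]) f" "recursive_on (\<lambda>n. [n]) g" for t f g
    unfolding row_code_eq
    by (simp add: lessThan_Suc add.assoc del: One_nat_def)
      (intro recursive_on_add recursive_on_const recursive_on_power2 recursive_on_prod_encode that)
  have "recursive_on (\<lambda>n. [n]) (\<lambda>n. 2 ^ c + 2 ^ prod_encode (1, prod_encode (s,
      n + (2 ^ row_code [kIn, n, 0, 0] + (\<Sum>i<n. 2 ^ row_code [kS, i, Suc i, 0])))))"
    by (intro recursive_on_add recursive_on_const recursive_on_power2 recursive_on_prod_encode
        recursive_on_sum row recursive_on_Suc id)
  then obtain r where "\<And>n. computes r [n] (2 ^ c + 2 ^ prod_encode (1, prod_encode (s,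
      n + (2 ^ row_code [kIn, n, 0, 0] + (\<Sum>i<n. 2 ^ row_code [kS, i, Suc i, 0])))))"
    unfolding recursive_on_def by auto
  then show ?thesis
    using that[of r] by (simp add: assms rows_code_input)
qed

section \<open>Correctness of the reduction\<close>

lemma rows4_input: "rows4 (root_rows h \<union> input_rows n)"
  using finite_prog prog_truth(1) by (fastforce simp: rows4_def root_rows_def input_rows_def)

text \<open>An outcome keeps the program and the input and obeys the rules, so
  \<open>eval_computes\<close> yields the fact that the denial forbids.\<close>

lemma outcomes_empty:
  assumes "computes h [n] 1"
  shows "outcomes eval_proc (db_of (root_rows h \<union> input_rows n)) = {}"
proof -
  have False if "J \<in> outcomes eval_proc (db_of (root_rows h \<union> input_rows n))" for J
  proof -
    let ?F = "fact J"
    have facts: "?F t a b c" if "[t, a, b, c] \<in> root_rows h \<union> input_rows n" for t a b c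
      using \<open>J \<in> _\<close> that unfolding outcomes_iff[OF rows4_input] by blast
    from that have closed: "eval_closed ?F"
      and goal: "\<not> (\<exists>p n l m. ?F kRoot p 0 0 \<and> ?F kIn n 0 0 \<and> ?F kC l n 0 \<and> ?F kS 0 m 0 \<and> ?F kEval p l m)"
      unfolding outcomes_iff[OF rows4_input] using models_post_iff by blast+
    interpret eval_closed ?F by (rule closed)
    have "has (prog h)" using facts by (simp add: has_def root_rows_def)
    have "num i i" if "i \<le> n" for i
      using that
    proof (induction i)
      case (Suc i)
      then have "?F kS i (Suc i) 0" by (intro facts) (auto simp: input_rows_def)
      with Suc show ?case by (auto intro: num_Suc)
    qed (rule num_0)
    then have "num n n" by simp
    with num_elem ex_C elem_0 obtain l where l: "?F kC l n 0" by blast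
    with \<open>num n n\<close> have "nums l [n]" by (auto intro: nums_Cons nums_Nil)
    with eval_computes assms \<open>has (prog h)\<close> obtain v where v: "?F kEval (to_nat h) l v" "num v 1"
      by blast
    \<comment> \<open>A representative of \<open>1\<close> succeeds a representative of zero, and
      that is \<open>0\<close> itself.\<close>
    then have "?F kS 0 v 0" by (auto elim!: num.cases[of v] num_0E elim: num_SucE)
    moreover have "?F kRoot (to_nat h) 0 0" "?F kIn n 0 0"
      by (auto intro!: facts simp: root_rows_def input_rows_def)
    ultimately show False using goal l v(1) by blast
  qed
  then show ?thesis by blast
qed

text \<open>The outcome is the finite model for a \<open>B\<close> above the derivation of
  \<open>0\<close> and all initial entries.\<close>

lemma outcomes_nonempty:
  assumes "computes h [n] 0"
  shows "outcomes eval_proc (db_of (root_rows h \<union> input_rows n)) \<noteq> {}"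
proof -
  let ?X = "root_rows h \<union> input_rows n"
  have "\<forall>\<^sub>F B in sequentially. \<forall>v \<in> \<Union> (set ` ?X). v \<le> B"
    using rows4_input[of h n] by (intro eventually_ball_finite) (auto simp: rows4_def eventually_ge_at_top)
  \<comment> \<open>With \<open>B\<close> above 1 the successor of zero is not cut off: it is
    exactly 1.\<close>
  with eventually_bounded_computes[OF assms] eventually_gt_at_top[of 1]
  have "\<forall>\<^sub>F B in sequentially. bounded_computes B h [n] 0 \<and> 1 < B \<and> (\<forall>v \<in> \<Union> (set ` ?X). v \<le> B)"
    by eventually_elim blast
  from eventually_happens'[OF sequentially_bot this]
  obtain B where B: "bounded_computes B h [n] 0" "1 < B" "\<And>x v. x \<in> ?X \<Longrightarrow> v \<in> set x \<Longrightarrow> v \<le> B"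
    by blast
  define Y where "Y = {[t, a, b, c] |t a b c. model B h n t a b c}"
  have "Y \<subseteq> {xs. set xs \<subseteq> {..max 18 B} \<and> length xs = 4}"
    by (auto simp: Y_def model_def)
  then have Y: "rows4 Y"
    unfolding rows4_def using finite_lists_length_eq[of "{..max 18 B}" 4] by (auto intro: finite_subset)
  have F: "fact (db_of Y) = model B h n"
    by (intro ext, unfold fact_db_of[OF Y]) (simp add: Y_def)
  have "\<not> (\<exists>p i l m. model B h n kRoot p 0 0 \<and> model B h n kIn i 0 0 \<and> model B h n kC l i 0 \<and>
      model B h n kS 0 m 0 \<and> model B h n kEval p l m)"
  proof (intro notI, elim exE conjE)
    fix p i l m
    assume G: "model B h n kRoot p 0 0" "model B h n kIn i 0 0" "model B h n kC l i 0"
      "model B h n kS 0 m 0" "model B h n kEval p l m"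
    from G(1,2,4) B(2) have p: "p = to_nat h" and i: "i = n" and m: "m = 1"
      by (simp_all add: model_def truth_def)
    from G(3) have "l = min B (list_encode [n])" unfolding i by (simp add: model_def truth_def)
    with bounded_computes_less[OF B(1)] have l: "l = list_encode [n]" by linarith
    from model_EvalD[OF G(5)[unfolded p l] B(1)] m show False by simp
  qed
  with eval_closed_model[of B h n] B(2) have "models (db_of Y) (post eval_proc)"
    by (subst models_post_iff) (auto simp: F ext_db_of)
  moreover have "model B h n t a b c" if "[t, a, b, c] \<in> ?X" for t a b c
  proof -
    have le: "t \<le> B" "a \<le> B" "b \<le> B" "c \<le> B"
      using B(3)[OF that] by simp_all
    consider "[t, a, b, c] \<in> prog h" | "[t, a, b, c] = [kRoot, to_nat h, 0, 0]"
      | "[t, a, b, c] = [kIn, n, 0, 0]" | i where "[t, a, b, c] = [kS, i, Suc i, 0]"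
      using \<open>[t, a, b, c] \<in> ?X\<close> unfolding root_rows_def input_rows_def by blast
    then have "t < 18 \<and> truth B h n t a b c"
    proof cases
      case 1
      from prog_truth(1)[OF this] show ?thesis by auto
    qed (use le in \<open>simp_all add: truth_def\<close>)
    with le show ?thesis by (simp add: model_def)
  qed
  ultimately have "db_of Y \<in> outcomes eval_proc (db_of ?X)"
    unfolding outcomes_iff[OF rows4_input] by (simp add: F ext_db_of db_wf_db_of[OF Y])
  then show ?thesis by blast
qed

theorem proposition2:
  shows "\<exists>P. proc_wf P \<and> pre P = {} \<and> (\<forall>c \<in> post P. is_Tgd c) \<and>
    \<not> decidable_on db_code {I. db_wf I} (\<lambda>I. outcomes P I \<noteq> {})"
proof (intro exI conjI)
  show "proc_wf eval_proc" by (rule proc_wf_eval_proc)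
  show "pre eval_proc = {}" by (simp add: eval_proc_def)
  show "\<forall>c \<in> post eval_proc. is_Tgd c" by (auto simp: eval_proc_def tgd_def)
  show "\<not> decidable_on db_code {I. db_wf I} (\<lambda>I. outcomes eval_proc I \<noteq> {})"
  proof
    assume "decidable_on db_code {I. db_wf I} (\<lambda>I. outcomes eval_proc I \<noteq> {})"
    then obtain f where f: "\<And>I. db_wf I \<Longrightarrow>
        computes f [db_code I] (if outcomes eval_proc I \<noteq> {} then 1 else 0)"
      unfolding decidable_on_def by blast
    obtain c s where "\<And>X. db_code (db_of X) = 2 ^ c + 2 ^ prod_encode (1, prod_encode (s, rows_code X))"
      by (rule db_code_db_of) blast
    then obtain r where r: "\<And>h. computes r [rows_code (root_rows h)]
        (db_code (db_of (root_rows h \<union> input_rows (rows_code (root_rows h)))))"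
      using recursive_db_code by blast
    \<comment> \<open>On the code \<open>n\<close> of its own rows, \<open>h\<close> asks the
      decider about the instance that runs \<open>h\<close> on \<open>n\<close>. The answer 1 would
      make the outcomes empty and the answer 0 nonempty, against the decider in both cases.\<close>
    define h where "h = Comp f [r]"
    define n where "n = rows_code (root_rows h)"
    define I where "I = db_of (root_rows h \<union> input_rows n)"
    have "computes h [n] (if outcomes eval_proc I \<noteq> {} then 1 else 0)"
      unfolding h_def
    proof (rule computes.comp)
      show "list_all2 (\<lambda>g y. computes g [n] y) [r] [db_code I]"
        using r[of h] by (simp add: n_def I_def)
      show "computes f [db_code I] (if outcomes eval_proc I \<noteq> {} then 1 else 0)"
        by (rule f) (simp add: I_def db_wf_db_of[OF rows4_input])
    qed
    then show False
      using outcomes_empty[of h n] outcomes_nonempty[of h n] by (auto simp: I_def split: if_splits)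
  qed
qed

end
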